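(* Let $B$ be a unital Banach algebra over $\mathbb{C}$ and $\theta\in B^d$ with $\theta(1)=1$. For any $q\in\mathcal{Z}(B^d)$ the following conditions are equivalent: (1) there exists $p\in\mathcal{Z}(B^d)$ such that $D[p]=q$; (2) $q\in\ker(\Theta_{\mathcal{Z}(B^d)})$.
   Context: $B^d$ is the topological dual of $B$; $M_n(B)=M_n(\mathbb{C})\otimes B$ with its natural topology; $M(B)=(M_n(B))_{n\ge1}$. $A(M(B))$ is the unital algebra (levelwise operations) of families $f=(f_n)_{n\ge1}$ of analytic maps $f_n:M_n(B)\to M_n(\mathbb{C})$ with $f_{m+n}(\beta\oplus\beta')=f_m(\beta)\oplus f_n(\beta')$ and $f_n((s\otimes1)\beta(s\otimes1)^{-1})=sf_n(\beta)s^{-1}$ for $s\in GL_n(\mathbb{C})$. For $\varphi\in B^d$, $z(\varphi)\in A(M(B))$ is $z(\varphi)_n=\mathrm{id}_{M_n(\mathbb{C})}\otimes\varphi$ (apply $\varphi$ entrywise). $\mathcal{Z}(B^d)$ is the unital subalgebra of $A(M(B))$ generated by $\{z(\varphi):\varphi\in B^d\}$, and $\mathcal{Z}(1^\perp)$ the unital subalgebra generated by $\{z(\varphi):\varphi\in B^d,\ \varphi(1)=0\}$. By a result of Voiculescu, $\mathcal{Z}(1^\perp)$ and $z(\theta)$ are algebraically free and $\mathcal{Z}(B^d)=\mathcal{Z}(1^\perp)\langle z(\theta)\rangle$ is the algebraic free product of $\mathcal{Z}(1^\perp)$ with the polynomial algebra in $z(\theta)$; hence $\mathcal{Z}(B^d)$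 is spanned by monomials $c_0z(\theta)c_1\cdots z(\theta)c_n$ with $c_i\in\mathcal{Z}(1^\perp)$, and there is a well-defined linear map $\rho$ on $\mathcal{Z}(B^d)$ with $\rho[c_0z(\theta)c_1\cdots z(\theta)c_n]=c_1z(\theta)c_2\cdots z(\theta)c_nz(\theta)c_0$. Put $\Theta_{\mathcal{Z}(B^d)}=\mathrm{id}-\rho$. The cyclic derivative $D$ on $A(M(B))$ is $(Df)_n(\beta)=\mathrm{mult}(\sigma((\partial f)_{n;n}(\beta;\beta)))$ with $\sigma(a\otimes b)=b\otimes a$, $\mathrm{mult}(a\otimes b)=ab$, and $$(\partial f)_{m;n}(\beta;\beta')=\sum_{1\le a,b\le m,\,1\le c,d\le n}\Big(\tfrac{d}{d\epsilon}f_{m+n}\big(\left[\begin{smallmatrix}\beta&\epsilon e^{(m,n)}_{b,c}\otimes1\\0&\beta'\end{smallmatrix}\right]\big)\big|_{\epsilon=0}\Big)_{(a,m+d)}e^{(m)}_{a,b}\otimes e^{(n)}_{c,d}$$ ($e$'s are matrix units). On monomials, $D[z(\varphi_1)\cdots z(\varphi_k)]=\sum_{i=1}^k\varphi_i(1)z(\varphi_{i+1})\cdots z(\varphi_k)z(\varphi_1)\cdots z(\varphi_{i-1})$, so $D$ maps $\mathcal{Z}(B^d)$ into itself. *)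

theory Defs
  imports
    "HOL-Analysis.Derivative"
    "HOL-Library.FuncSet"
    "Jordan_Normal_Form.Matrix"
begin

section \<open>Unital complex Banach algebras and their duals\<close>

text \<open>The libraries only have real Banach algebras; the class adds a compatible complex structure.
  The norm of the unit is not required to be 1.\<close>

class complex_banach_algebra_1 = real_normed_algebra + ring_1 + banach +
  fixes scaleC :: "complex \<Rightarrow> 'a \<Rightarrow> 'a" (infixr \<open>*\<^sub>C\<close> 75)
  assumes scaleC_add_right: "c *\<^sub>C (x + y) = c *\<^sub>C x + c *\<^sub>C y"
    and scaleC_add_left: "(c + d) *\<^sub>C x = c *\<^sub>C x + d *\<^sub>C x"
    and scaleC_scaleC: "c *\<^sub>C d *\<^sub>C x = (c * d) *\<^sub>C x"
    and scaleC_complex_of_real: "complex_of_real r *\<^sub>C x = r *\<^sub>R x"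
    and norm_scaleC: "norm (c *\<^sub>C x) = cmod c * norm x"
    and mult_scaleC_left: "(c *\<^sub>C x) * y = c *\<^sub>C (x * y)"
    and mult_scaleC_right: "x * (c *\<^sub>C y) = c *\<^sub>C (x * y)"

text \<open>A bounded real-linear functional that commutes with complex scalars is exactly a
  continuous complex-linear one.\<close>

definition top_dual :: "('b::complex_banach_algebra_1 \<Rightarrow> complex) set" where
  "top_dual = {\<phi>. bounded_linear \<phi> \<and> (\<forall>c x. \<phi> (c *\<^sub>C x) = c * \<phi> x)}"


section \<open>Analytic maps between matrix spaces\<close>

text \<open>The set of matrices of size \<open>n\<close> over \<open>B\<close> is \<open>carrier_mat n n\<close>. The sum of the entry norms
  induces its natural topology, and likewise for complex matrices.\<close>

definition mat_norm :: "'a::real_normed_vector mat \<Rightarrow> real" where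
  "mat_norm A = (\<Sum>i<dim_row A. \<Sum>j<dim_col A. norm (A $$ (i, j)))"

definition complex_scalar_mat :: "complex \<Rightarrow> 'b::complex_banach_algebra_1 mat \<Rightarrow> 'b mat" where
  "complex_scalar_mat c = map_mat ((*\<^sub>C) c)"

definition bounded_clinear_mat ::
    "nat \<Rightarrow> ('b::complex_banach_algebra_1 mat \<Rightarrow> complex mat) \<Rightarrow> bool" where
  "bounded_clinear_mat n L \<longleftrightarrow>
     L \<in> carrier_mat n n \<rightarrow> carrier_mat n n \<and>
     (\<forall>h \<in> carrier_mat n n. \<forall>k \<in> carrier_mat n n. L (h + k) = L h + L k) \<and>
     (\<forall>c. \<forall>h \<in> carrier_mat n n. L (complex_scalar_mat c h) = c \<cdot>\<^sub>m L h) \<and>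
     (\<exists>K. \<forall>h \<in> carrier_mat n n. mat_norm (L h) \<le> K * mat_norm h)"

text \<open>Analytic maps between complex Banach spaces: complex Frechet differentiable at every point.\<close>

definition analytic_mat ::
    "nat \<Rightarrow> ('b::complex_banach_algebra_1 mat \<Rightarrow> complex mat) \<Rightarrow> bool" where
  "analytic_mat n F \<longleftrightarrow>
     (\<forall>\<beta> \<in> carrier_mat n n. \<exists>L. bounded_clinear_mat n L \<and>
        (\<forall>e>0. \<exists>d>0. \<forall>h \<in> carrier_mat n n. mat_norm h < d \<longrightarrow>
           mat_norm (F (\<beta> + h) - F \<beta> - L h) \<le> e * mat_norm h))"


section \<open>The algebra of analytic fully matricial families\<close>

text \<open>Families indexed by \<open>n \<ge> 1\<close>, extensional in the index and in the matrix argument, so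
  that HOL equality is equality of families.\<close>

type_synonym 'b family = "nat \<Rightarrow> 'b mat \<Rightarrow> complex mat"

definition mk_family :: "(nat \<Rightarrow> 'b mat \<Rightarrow> complex mat) \<Rightarrow> 'b family" where
  "mk_family F = (\<lambda>n\<in>{1..}. \<lambda>\<beta>\<in>carrier_mat n n. F n \<beta>)"

definition families :: "'b family set" where
  "families = (\<Pi>\<^sub>E n\<in>{1..}. carrier_mat n n \<rightarrow>\<^sub>E carrier_mat n n)"

definition fam_zero :: "'b family" where
  "fam_zero = mk_family (\<lambda>n \<beta>. 0\<^sub>m n n)"

definition fam_one :: "'b family" where
  "fam_one = mk_family (\<lambda>n \<beta>. 1\<^sub>m n)"

definition fam_add :: "'b family \<Rightarrow> 'b family \<Rightarrow> 'b family" where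
  "fam_add f g = mk_family (\<lambda>n \<beta>. f n \<beta> + g n \<beta>)"

definition fam_diff :: "'b family \<Rightarrow> 'b family \<Rightarrow> 'b family" where
  "fam_diff f g = mk_family (\<lambda>n \<beta>. f n \<beta> - g n \<beta>)"

definition fam_scale :: "complex \<Rightarrow> 'b family \<Rightarrow> 'b family" where
  "fam_scale c f = mk_family (\<lambda>n \<beta>. c \<cdot>\<^sub>m f n \<beta>)"

definition fam_mult :: "'b family \<Rightarrow> 'b family \<Rightarrow> 'b family" where
  "fam_mult f g = mk_family (\<lambda>n \<beta>. f n \<beta> * g n \<beta>)"

definition mat_dsum :: "'a::zero mat \<Rightarrow> 'a mat \<Rightarrow> 'a mat" where
  "mat_dsum A C = four_block_mat A (0\<^sub>m (dim_row A) (dim_col C)) (0\<^sub>m (dim_row C) (dim_col A)) C"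

text \<open>\<open>amplify s\<close> is \<open>s \<otimes> 1\<close>.\<close>

definition amplify :: "complex mat \<Rightarrow> 'b::complex_banach_algebra_1 mat" where
  "amplify = map_mat (\<lambda>c. c *\<^sub>C 1)"

definition AM :: "'b::complex_banach_algebra_1 family set" where
  "AM = {f \<in> families.
     (\<forall>n\<ge>1. analytic_mat n (f n)) \<and>
     (\<forall>m\<ge>1. \<forall>n\<ge>1. \<forall>\<beta> \<in> carrier_mat m m. \<forall>\<beta>' \<in> carrier_mat n n.
        f (m + n) (mat_dsum \<beta> \<beta>') = mat_dsum (f m \<beta>) (f n \<beta>')) \<and>
     (\<forall>n\<ge>1. \<forall>s \<in> carrier_mat n n. \<forall>t \<in> carrier_mat n n. inverts_mat s t \<and> inverts_mat t s \<longrightarrow>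
        (\<forall>\<beta> \<in> carrier_mat n n. f n (amplify s * \<beta> * amplify t) = s * f n \<beta> * t))}"

definition unital_subalgebra :: "'b::complex_banach_algebra_1 family set \<Rightarrow> bool" where
  "unital_subalgebra S \<longleftrightarrow> S \<subseteq> AM \<and> fam_one \<in> S \<and>
     (\<forall>f \<in> S. \<forall>g \<in> S. fam_add f g \<in> S) \<and>
     (\<forall>c. \<forall>f \<in> S. fam_scale c f \<in> S) \<and>
     (\<forall>f \<in> S. \<forall>g \<in> S. fam_mult f g \<in> S)"

definition generated_subalgebra ::
    "'b::complex_banach_algebra_1 family set \<Rightarrow> 'b family set" where
  "generated_subalgebra X = \<Inter> {S. unital_subalgebra S \<and> X \<subseteq> S}"

definition zmap :: "('b \<Rightarrow> complex) \<Rightarrow> 'b family" where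
  "zmap \<phi> = mk_family (\<lambda>n. map_mat \<phi>)"

definition Z_dual :: "'b::complex_banach_algebra_1 family set" where
  "Z_dual = generated_subalgebra {zmap \<phi> | \<phi>. \<phi> \<in> top_dual}"

definition Z_perp :: "'b::complex_banach_algebra_1 family set" where
  "Z_perp = generated_subalgebra {zmap \<phi> | \<phi>. \<phi> \<in> top_dual \<and> \<phi> 1 = 0}"


section \<open>The rotation map and \<open>\<Theta>\<close>\<close>

text \<open>\<open>theta_monomial \<theta> [c\<^sub>0, \<dots>, c\<^sub>n]\<close> is \<open>c\<^sub>0 z(\<theta>) c\<^sub>1 \<cdots> z(\<theta>) c\<^sub>n\<close>; the value on
  \<open>[]\<close> plays no role.\<close>

fun theta_monomial :: "('b \<Rightarrow> complex) \<Rightarrow> 'b family list \<Rightarrow> 'b family" where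
  "theta_monomial \<theta> [] = fam_one"
| "theta_monomial \<theta> [c] = c"
| "theta_monomial \<theta> (c # d # cs) = fam_mult (fam_mult c (zmap \<theta>)) (theta_monomial \<theta> (d # cs))"

definition is_rotation ::
    "('b::complex_banach_algebra_1 \<Rightarrow> complex) \<Rightarrow> ('b family \<Rightarrow> 'b family) \<Rightarrow> bool" where
  "is_rotation \<theta> r \<longleftrightarrow>
     r \<in> Z_dual \<rightarrow>\<^sub>E Z_dual \<and>
     (\<forall>f \<in> Z_dual. \<forall>g \<in> Z_dual. r (fam_add f g) = fam_add (r f) (r g)) \<and>
     (\<forall>c. \<forall>f \<in> Z_dual. r (fam_scale c f) = fam_scale c (r f)) \<and>
     (\<forall>cs. cs \<noteq> [] \<and> set cs \<subseteq> Z_perp \<longrightarrow>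
        r (theta_monomial \<theta> cs) = theta_monomial \<theta> (rotate1 cs))"

text \<open>For \<open>\<theta>\<close> in the dual with \<open>\<theta> 1 = 1\<close> there is exactly one such map: it exists
  because \<open>Z_dual\<close> is the free product of \<open>Z_perp\<close> and the polynomials in \<open>zmap \<theta>\<close>,
  and it is unique because the monomials span \<open>Z_dual\<close>.\<close>

definition rho ::
    "('b::complex_banach_algebra_1 \<Rightarrow> complex) \<Rightarrow> 'b family \<Rightarrow> 'b family" where
  "rho \<theta> = (THE r. is_rotation \<theta> r)"

definition Theta ::
    "('b::complex_banach_algebra_1 \<Rightarrow> complex) \<Rightarrow> 'b family \<Rightarrow> 'b family" where
  "Theta \<theta> f = fam_diff f (rho \<theta> f)"

definition ker_Theta :: "('b::complex_banach_algebra_1 \<Rightarrow> complex) \<Rightarrow> 'b family set" where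
  "ker_Theta \<theta> = {f \<in> Z_dual. Theta \<theta> f = fam_zero}"


section \<open>The cyclic derivative\<close>

text \<open>Matrix units, with indices starting from 0.\<close>

definition mat_unit :: "nat \<Rightarrow> nat \<Rightarrow> nat \<Rightarrow> nat \<Rightarrow> 'a::zero_neq_one mat" where
  "mat_unit m n i j = mat m n (\<lambda>kl. if kl = (i, j) then 1 else 0)"

text \<open>An element of \<open>M\<^sub>m(\<complex>) \<otimes> M\<^sub>n(\<complex>)\<close> is given by its coefficients \<open>T a b c d\<close> in the basis
  \<open>e\<^sub>a\<^sub>b \<otimes> e\<^sub>c\<^sub>d\<close>. Accordingly \<open>tensor_flip\<close> is \<open>\<sigma>\<close> and \<open>tensor_mult n\<close> is the
  linear extension of \<open>e\<^sub>a\<^sub>b \<otimes> e\<^sub>c\<^sub>d \<mapsto> e\<^sub>a\<^sub>b e\<^sub>c\<^sub>d\<close>.\<close>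

type_synonym tensor = "nat \<Rightarrow> nat \<Rightarrow> nat \<Rightarrow> nat \<Rightarrow> complex"

definition free_diff ::
    "'b::complex_banach_algebra_1 family \<Rightarrow> nat \<Rightarrow> nat \<Rightarrow> 'b mat \<Rightarrow> 'b mat \<Rightarrow> tensor" where
  "free_diff f m n \<beta> \<beta>' a b c d =
     deriv (\<lambda>\<epsilon>. f (m + n)
       (four_block_mat \<beta> (amplify (\<epsilon> \<cdot>\<^sub>m mat_unit m n b c)) (0\<^sub>m n m) \<beta>') $$ (a, m + d)) 0"

definition tensor_flip :: "tensor \<Rightarrow> tensor" where
  "tensor_flip T a b c d = T c d a b"

definition tensor_mult :: "nat \<Rightarrow> tensor \<Rightarrow> complex mat" where
  "tensor_mult n T = mat n n (\<lambda>kl. \<Sum>a<n. \<Sum>b<n. \<Sum>c<n. \<Sum>d<n.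
     T a b c d * (mat_unit n n a b * mat_unit n n c d) $$ kl)"

definition cyclic_deriv :: "'b::complex_banach_algebra_1 family \<Rightarrow> 'b family" where
  "cyclic_deriv f = mk_family (\<lambda>n \<beta>. tensor_mult n (tensor_flip (free_diff f n n \<beta> \<beta>)))"

end

theory Submission
  imports Defs
begin

text \<open>Write \<open>z(\<phi>)\<close> for \<open>zmap \<phi>\<close>, \<open>D\<close> for the cyclic derivative and \<open>\<rho>\<close> for the rotation. The argument
  is a computation on the monomials \<open>c\<^sub>0 z(\<theta>) c\<^sub>1 \<cdots> z(\<theta>) c\<^sub>n\<close> with all \<open>c\<^sub>i\<close> in \<open>Z_perp\<close>, which span
  \<open>Z_dual\<close>. For a monomial \<open>x = c\<^sub>1 z(\<theta>) c\<^sub>2 \<cdots> z(\<theta>) c\<^sub>n\<close> with \<open>n\<close> factors from \<open>Z_perp\<close>, the derivative of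
  \<open>x z(\<theta>)\<close> is the sum \<open>x + \<rho> x + \<cdots> + \<rho>\<^sup>n\<^sup>-\<^sup>1 x\<close> (\<open>insert_deriv_alt_prod_snoc_one\<close>), because \<open>D\<close> kills
  \<open>Z_perp\<close> and \<open>z(\<theta>)\<close> contributes \<open>\<theta> 1 = 1\<close>. As \<open>D (f g) = D (g f)\<close>, the derivative of every monomial is
  such a sum or zero, and since \<open>\<rho>\<^sup>n x = x\<close> it is fixed by \<open>\<rho>\<close> (\<open>rot_insert_deriv\<close>). Conversely the
  average of \<open>x\<close> over its rotations is \<open>D\<close> of \<open>x z(\<theta>) / n\<close>, so by linearity the average of any \<open>q\<close> over
  \<open>M\<close> successive rotations is a derivative, if \<open>M\<close> is a common multiple of the periods of its monomials
  (\<open>rotation_average_is_deriv\<close>). If \<open>\<rho> q = q\<close>, this average is \<open>q\<close>.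

  It remains to show that \<open>\<rho>\<close> exists, that is, that rotating the monomials respects the linear
  relations between them. The entry in the upper right corner of \<open>f\<close> at the matrix with
  superdiagonal \<open>b\<^sub>1, \<dots>, b\<^sub>k\<close> is, for \<open>f\<close> in \<open>Z_dual\<close>, a multilinear form in \<open>b\<^sub>1, \<dots>, b\<^sub>k\<close> that sends the word
  \<open>z(\<phi>\<^sub>1) \<cdots> z(\<phi>\<^sub>k)\<close> to \<open>\<phi>\<^sub>1 (b\<^sub>1) \<cdots> \<phi>\<^sub>k (b\<^sub>k)\<close> and words of other length to zero. These forms
  determine \<open>f\<close> (\<open>coef_inject\<close>), and on them the rotation has an explicit formula, \<open>rot_coef\<close>, which is
  visibly linear. Hence \<open>\<rho>\<close> is well defined (\<open>rho_eq\<close>).\<close>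


section \<open>The ring of matricial families\<close>

lemma mk_family_apply [simp]:
  "n \<ge> 1 \<Longrightarrow> \<beta> \<in> carrier_mat n n \<Longrightarrow> mk_family F n \<beta> = F n \<beta>"
  by (simp add: mk_family_def)

lemma mk_family_in_families:
  assumes "\<And>n \<beta>. n \<ge> 1 \<Longrightarrow> \<beta> \<in> carrier_mat n n \<Longrightarrow> F n \<beta> \<in> carrier_mat n n"
  shows "mk_family F \<in> families"
  using assms by (fastforce simp: mk_family_def families_def)

lemma families_carrier:
  "f \<in> families \<Longrightarrow> n \<ge> 1 \<Longrightarrow> \<beta> \<in> carrier_mat n n \<Longrightarrow> f n \<beta> \<in> carrier_mat n n"
  by (auto simp: families_def dest!: PiE_mem[where x = n])

lemma families_dim:
  assumes "f \<in> families" "n \<ge> 1" "\<beta> \<in> carrier_mat n n"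
  shows "dim_row (f n \<beta>) = n" "dim_col (f n \<beta>) = n"
  using families_carrier[OF assms] by auto

lemma families_eqI:
  assumes "f \<in> families" "g \<in> families"
    and eq: "\<And>n \<beta>. n \<ge> 1 \<Longrightarrow> \<beta> \<in> carrier_mat n n \<Longrightarrow> f n \<beta> = g n \<beta>"
  shows "f = g"
proof (rule PiE_ext)
  show "f \<in> (\<Pi>\<^sub>E n\<in>{1..}. carrier_mat n n \<rightarrow>\<^sub>E carrier_mat n n)"
    "g \<in> (\<Pi>\<^sub>E n\<in>{1..}. carrier_mat n n \<rightarrow>\<^sub>E carrier_mat n n)"
    using assms by (auto simp: families_def)
next
  fix n :: nat assume n: "n \<in> {1..}"
  have "f n \<in> carrier_mat n n \<rightarrow>\<^sub>E carrier_mat n n" "g n \<in> carrier_mat n n \<rightarrow>\<^sub>E carrier_mat n n"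
    using assms(1,2) n by (auto simp: families_def dest!: PiE_mem[where x = n])
  then show "f n = g n"
    by (rule PiE_ext) (use eq n in auto)
qed

lemma fam_ops_in_families:
  "fam_zero \<in> families" "fam_one \<in> families"
  "f \<in> families \<Longrightarrow> g \<in> families \<Longrightarrow> fam_add f g \<in> families"
  "f \<in> families \<Longrightarrow> g \<in> families \<Longrightarrow> fam_diff f g \<in> families"
  "f \<in> families \<Longrightarrow> g \<in> families \<Longrightarrow> fam_mult f g \<in> families"
  "f \<in> families \<Longrightarrow> fam_scale c f \<in> families"
  "zmap \<phi> \<in> families"
  by (simp_all add: fam_zero_def fam_one_def fam_add_def fam_diff_def fam_mult_def fam_scale_def
    zmap_def mk_family_in_families families_carrier
    mult_carrier_mat[OF families_carrier families_carrier] minus_carrier_mat[OF families_carrier])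

text \<open>The families form a ring under the levelwise operations, with a compatible
  multiplication \<open>scale\<close> by complex scalars. As a type of their own they can be computed
  with in class \<open>ring_1\<close>.\<close>

typedef 'b mfam = "families :: 'b family set"
  using fam_ops_in_families(1) by blast

setup_lifting type_definition_mfam

instantiation mfam :: (type) ring_1
begin

lift_definition zero_mfam :: "'a mfam" is fam_zero by (rule fam_ops_in_families)
lift_definition one_mfam :: "'a mfam" is fam_one by (rule fam_ops_in_families)
lift_definition plus_mfam :: "'a mfam \<Rightarrow> 'a mfam \<Rightarrow> 'a mfam" is fam_add
  by (rule fam_ops_in_families)
lift_definition minus_mfam :: "'a mfam \<Rightarrow> 'a mfam \<Rightarrow> 'a mfam" is fam_diff
  by (rule fam_ops_in_families)
lift_definition times_mfam :: "'a mfam \<Rightarrow> 'a mfam \<Rightarrow> 'a mfam" is fam_mult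
  by (rule fam_ops_in_families)
lift_definition uminus_mfam :: "'a mfam \<Rightarrow> 'a mfam" is "fam_scale (- 1)"
  by (rule fam_ops_in_families)

instance
proof
  fix a b c :: "'a mfam"
  show "a + b + c = a + (b + c)"
    by transfer (rule families_eqI, simp_all add: fam_ops_in_families,
      simp add: fam_add_def
        assoc_add_mat[OF families_carrier families_carrier families_carrier])
  show "a + b = b + a"
    by transfer (rule families_eqI, simp_all add: fam_ops_in_families,
      simp add: fam_add_def comm_add_mat[OF families_carrier families_carrier])
  show "0 + a = a"
    by transfer (rule families_eqI, simp_all add: fam_ops_in_families,
      simp add: fam_add_def fam_zero_def left_add_zero_mat[OF families_carrier])
  show "- a + a = 0"
    by transfer (rule families_eqI, simp_all add: fam_ops_in_families,
      auto intro!: eq_matI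
      simp: families_dim fam_add_def fam_zero_def fam_scale_def)
  show "a - b = a + - b"
    by transfer (rule families_eqI, simp_all add: fam_ops_in_families,
      auto intro!: eq_matI
      simp: families_dim fam_add_def fam_diff_def fam_scale_def)
  show "a * b * c = a * (b * c)"
    by transfer (rule families_eqI, simp_all add: fam_ops_in_families,
      simp add: fam_mult_def
        assoc_mult_mat[OF families_carrier families_carrier families_carrier])
  show "1 * a = a" "a * 1 = a"
    by (transfer, rule families_eqI, simp_all add: fam_ops_in_families,
      simp add: fam_mult_def fam_one_def left_mult_one_mat[OF families_carrier]
        right_mult_one_mat[OF families_carrier])+
  show "(a + b) * c = a * c + b * c"
    by transfer (rule families_eqI, simp_all add: fam_ops_in_families,
      simp add: fam_mult_def fam_add_def
        add_mult_distrib_mat[OF families_carrier families_carrier families_carrier])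
  show "a * (b + c) = a * b + a * c"
    by transfer (rule families_eqI, simp_all add: fam_ops_in_families,
      simp add: fam_mult_def fam_add_def
        mult_add_distrib_mat[OF families_carrier families_carrier families_carrier])
  show "(0::'a mfam) \<noteq> 1"
  proof (transfer, rule notI)
    \<comment> \<open>The two families are told apart on any matrix of size 1.\<close>
    let ?\<beta> = "mat 1 1 (\<lambda>_. undefined) :: 'a mat"
    assume "(fam_zero :: 'a family) = fam_one"
    then have "(fam_zero :: 'a family) 1 ?\<beta> $$ (0, 0) = fam_one 1 ?\<beta> $$ (0, 0)" by simp
    then show False by (simp add: fam_zero_def fam_one_def)
  qed
qed

end

lift_definition scale :: "complex \<Rightarrow> 'b mfam \<Rightarrow> 'b mfam" is fam_scale
  by (rule fam_ops_in_families)

text \<open>The \<open>(i, j)\<close> entry of level \<open>n\<close> of \<open>f\<close> at \<open>\<beta>\<close>; it is meaningful only for \<open>n \<ge> 1\<close>,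
  \<open>\<beta>\<close> of size \<open>n\<close> and \<open>i, j < n\<close>.\<close>

definition entry :: "'b mfam \<Rightarrow> nat \<Rightarrow> 'b mat \<Rightarrow> nat \<Rightarrow> nat \<Rightarrow> complex" where
  "entry f n \<beta> i j = Rep_mfam f n \<beta> $$ (i, j)"

lemma Rep_mfam_carrier:
  "n \<ge> 1 \<Longrightarrow> \<beta> \<in> carrier_mat n n \<Longrightarrow> Rep_mfam f n \<beta> \<in> carrier_mat n n"
  by (rule families_carrier[OF Rep_mfam])

lemma mfam_eqI:
  assumes "\<And>n \<beta> i j. n \<ge> 1 \<Longrightarrow> \<beta> \<in> carrier_mat n n \<Longrightarrow> i < n \<Longrightarrow> j < n \<Longrightarrow>
    entry f n \<beta> i j = entry g n \<beta> i j"
  shows "f = g"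
proof -
  have "Rep_mfam f n \<beta> = Rep_mfam g n \<beta>" if n: "n \<ge> 1" "\<beta> \<in> carrier_mat n n" for n \<beta>
    using Rep_mfam_carrier[OF n, of f] Rep_mfam_carrier[OF n, of g] assms[OF n, unfolded entry_def]
    by (intro eq_matI) auto
  then have "Rep_mfam f = Rep_mfam g"
    by (rule families_eqI[OF Rep_mfam Rep_mfam])
  then show ?thesis
    by (simp add: Rep_mfam_inject)
qed

text \<open>The entries of a family are computed by the usual rules of matrix algebra.\<close>

context
  fixes n :: nat and \<beta> :: "'b mat" and i j :: nat
  assumes n: "n \<ge> 1" "\<beta> \<in> carrier_mat n n" and ij: "i < n" "j < n"
begin

lemma entry_zero: "entry 0 n \<beta> i j = 0"
  using n ij by (simp add: entry_def zero_mfam.rep_eq fam_zero_def)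

lemma entry_one: "entry 1 n \<beta> i j = (if i = j then 1 else 0)"
  using n ij by (simp add: entry_def one_mfam.rep_eq fam_one_def)

lemma entry_add: "entry (f + g) n \<beta> i j = entry f n \<beta> i j + entry g n \<beta> i j"
  using n ij Rep_mfam_carrier[OF n, of f] Rep_mfam_carrier[OF n, of g]
  by (simp add: entry_def plus_mfam.rep_eq fam_add_def)

lemma entry_diff: "entry (f - g) n \<beta> i j = entry f n \<beta> i j - entry g n \<beta> i j"
  using n ij Rep_mfam_carrier[OF n, of f] Rep_mfam_carrier[OF n, of g]
  by (simp add: entry_def minus_mfam.rep_eq fam_diff_def)

lemma entry_scale: "entry (scale c f) n \<beta> i j = c * entry f n \<beta> i j"
  using n ij Rep_mfam_carrier[OF n, of f]
  by (simp add: entry_def scale.rep_eq fam_scale_def)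

lemma entry_mult: "entry (f * g) n \<beta> i j = (\<Sum>e<n. entry f n \<beta> i e * entry g n \<beta> e j)"
  using n ij Rep_mfam_carrier[OF n, of f] Rep_mfam_carrier[OF n, of g]
  by (simp add: entry_def times_mfam.rep_eq fam_mult_def scalar_prod_def atLeast0LessThan)

end

lemmas entry_simps = entry_zero entry_one entry_add entry_diff entry_scale entry_mult

lemma scale_add_right: "scale c (f + g) = scale c f + scale c g"
  by (rule mfam_eqI) (simp add: entry_simps algebra_simps)

lemma scale_mult_left: "scale c f * g = scale c (f * g)"
  by (rule mfam_eqI) (simp add: entry_simps sum_distrib_left mult_ac)

lemma scale_mult_right: "f * scale c g = scale c (f * g)"
  by (rule mfam_eqI) (simp add: entry_simps sum_distrib_left mult_ac)

lemma scale_scale: "scale c (scale d f) = scale (c * d) f"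
  by (rule mfam_eqI) (simp add: entry_simps)

lemma scale_one [simp]: "scale 1 f = f"
  by (rule mfam_eqI) (simp add: entry_simps)

lemma scale_zero_left [simp]: "scale 0 f = 0"
  by (rule mfam_eqI) (simp add: entry_simps)

lemma scale_zero_right [simp]: "scale c 0 = 0"
  by (rule mfam_eqI) (simp add: entry_simps)

lemma scale_minus_one: "scale (- 1) f = - f"
  by transfer simp

lemma scale_sum: "scale c (\<Sum>i\<in>I. f i) = (\<Sum>i\<in>I. scale c (f i))"
  by (induction I rule: infinite_finite_induct) (simp_all add: scale_add_right)

lemma scale_of_nat: "scale (of_nat k) f = of_nat k * f"
proof (induction k)
  case (Suc k)
  have "scale (of_nat (Suc k)) f = f + scale (of_nat k) f"
    by (rule mfam_eqI) (simp add: entry_simps algebra_simps)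
  then show ?case
    by (simp add: Suc algebra_simps)
qed simp


section \<open>Analytic families\<close>

context
  fixes \<phi> :: "'b::complex_banach_algebra_1 \<Rightarrow> complex"
  assumes \<phi>: "\<phi> \<in> top_dual"
begin

lemma top_dual_add: "\<phi> (x + y) = \<phi> x + \<phi> y"
  and top_dual_diff: "\<phi> (x - y) = \<phi> x - \<phi> y"
  and top_dual_zero: "\<phi> 0 = 0"
  and top_dual_sum: "\<phi> (sum f I) = (\<Sum>i\<in>I. \<phi> (f i))"
  using \<phi> by (auto simp: top_dual_def linear_add linear_diff linear_0 linear_sum bounded_linear.linear)

lemma top_dual_scaleC: "\<phi> (c *\<^sub>C x) = c * \<phi> x"
  using \<phi> by (simp add: top_dual_def)

end

lemma mat_norm_nonneg: "mat_norm A \<ge> 0"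
  by (simp add: mat_norm_def sum_nonneg)

lemma mat_norm_carrier:
  "A \<in> carrier_mat n n \<Longrightarrow> mat_norm A = (\<Sum>i<n. \<Sum>j<n. norm (A $$ (i, j)))"
  by (simp add: mat_norm_def)

lemma mat_norm_add:
  assumes "A \<in> carrier_mat n n" "C \<in> carrier_mat n n"
  shows "mat_norm (A + C) \<le> mat_norm A + mat_norm C"
  using assms
  by (auto simp: mat_norm_def sum.distrib[symmetric] intro!: sum_mono norm_triangle_ineq)

lemma mat_norm_mult:
  fixes A C :: "complex mat"
  assumes A: "A \<in> carrier_mat n n" and C: "C \<in> carrier_mat n n"
  shows "mat_norm (A * C) \<le> mat_norm A * mat_norm C"
proof -
  have row: "(\<Sum>j<n. norm (C $$ (k, j))) \<le> mat_norm C" if "k < n" for k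
    unfolding mat_norm_carrier[OF C]
    by (rule member_le_sum[where f = "\<lambda>k. \<Sum>j<n. norm (C $$ (k, j))"])
      (use that in \<open>auto intro: sum_nonneg\<close>)
  have "mat_norm (A * C) = (\<Sum>i<n. \<Sum>j<n. norm (\<Sum>k<n. A $$ (i, k) * C $$ (k, j)))"
    unfolding mat_norm_carrier[OF mult_carrier_mat[OF A C]]
    using A C by (simp add: scalar_prod_def atLeast0LessThan)
  also have "\<dots> \<le> (\<Sum>i<n. \<Sum>j<n. \<Sum>k<n. norm (A $$ (i, k)) * norm (C $$ (k, j)))"
    by (intro sum_mono sum_norm_le) (simp add: norm_mult)
  also have "\<dots> = (\<Sum>i<n. \<Sum>k<n. norm (A $$ (i, k)) * (\<Sum>j<n. norm (C $$ (k, j))))"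
    by (subst sum.swap) (simp add: sum_distrib_left)
  also have "\<dots> \<le> (\<Sum>i<n. \<Sum>k<n. norm (A $$ (i, k)) * mat_norm C)"
    by (intro sum_mono mult_left_mono row) auto
  also have "\<dots> = mat_norm A * mat_norm C"
    by (simp add: mat_norm_carrier[OF A] sum_distrib_right)
  finally show ?thesis .
qed

text \<open>\<open>frechet_mat n F \<beta> L\<close> says that \<open>L\<close> is the complex Frechet derivative of \<open>F\<close> at \<open>\<beta>\<close>.\<close>

definition frechet_mat :: "nat \<Rightarrow> ('b::complex_banach_algebra_1 mat \<Rightarrow> complex mat) \<Rightarrow> 'b mat \<Rightarrow>
    ('b mat \<Rightarrow> complex mat) \<Rightarrow> bool" where
  "frechet_mat n F \<beta> L \<longleftrightarrow> bounded_clinear_mat n L \<and>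
     (\<forall>e>0. \<exists>d>0. \<forall>h \<in> carrier_mat n n. mat_norm h < d \<longrightarrow>
        mat_norm (F (\<beta> + h) - F \<beta> - L h) \<le> e * mat_norm h)"

lemma analytic_mat_iff:
  "analytic_mat n F \<longleftrightarrow> (\<forall>\<beta> \<in> carrier_mat n n. \<exists>L. frechet_mat n F \<beta> L)"
  by (simp add: analytic_mat_def frechet_mat_def)

lemma bounded_clinear_matI:
  assumes "\<And>h. h \<in> carrier_mat n n \<Longrightarrow> L h \<in> carrier_mat n n"
    and "\<And>h k. h \<in> carrier_mat n n \<Longrightarrow> k \<in> carrier_mat n n \<Longrightarrow> L (h + k) = L h + L k"
    and "\<And>c h. h \<in> carrier_mat n n \<Longrightarrow> L (complex_scalar_mat c h) = c \<cdot>\<^sub>m L h"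
    and "\<And>h. h \<in> carrier_mat n n \<Longrightarrow> mat_norm (L h) \<le> K * mat_norm h"
  shows "bounded_clinear_mat n L"
  using assms unfolding bounded_clinear_mat_def by blast

lemma bounded_clinear_matD:
  assumes "bounded_clinear_mat n L" "h \<in> carrier_mat n n"
  shows "L h \<in> carrier_mat n n"
    and "k \<in> carrier_mat n n \<Longrightarrow> L (h + k) = L h + L k"
    and "L (complex_scalar_mat c h) = c \<cdot>\<^sub>m L h"
  using assms by (auto simp: bounded_clinear_mat_def)

lemma bounded_clinear_mat_bound:
  assumes "bounded_clinear_mat n L"
  obtains K where "K \<ge> 0" "\<And>h. h \<in> carrier_mat n n \<Longrightarrow> mat_norm (L h) \<le> K * mat_norm h"
proof -
  from assms obtain K where K: "\<forall>h \<in> carrier_mat n n. mat_norm (L h) \<le> K * mat_norm h"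
    by (auto simp: bounded_clinear_mat_def)
  have "mat_norm (L h) \<le> max K 0 * mat_norm h" if "h \<in> carrier_mat n n" for h
    using K that by (meson max.cobounded1 mat_norm_nonneg mult_right_mono order_trans)
  then show thesis
    by (intro that[of "max K 0"]) auto
qed

lemma frechet_mat_const:
  assumes "C \<in> carrier_mat n n"
  shows "frechet_mat n (\<lambda>_. C) \<beta> (\<lambda>_. 0\<^sub>m n n)"
  unfolding frechet_mat_def
proof (intro conjI allI impI)
  show "bounded_clinear_mat n (\<lambda>_ :: 'a mat. 0\<^sub>m n n)"
    by (rule bounded_clinear_matI[where K = 0]) (auto simp: mat_norm_def)
  have "mat_norm (C - C - 0\<^sub>m n n) = 0"
    using assms by (simp add: mat_norm_def)
  then show "\<exists>d>0. \<forall>h\<in>carrier_mat n n. mat_norm h < d \<longrightarrow>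
      mat_norm (C - C - 0\<^sub>m n n) \<le> e * mat_norm h" if "e > 0" for e
    using that by (auto intro!: exI[of _ 1] simp: mat_norm_nonneg)
qed

lemma frechet_mat_functional:
  fixes \<phi> :: "'b::complex_banach_algebra_1 \<Rightarrow> complex"
  assumes \<phi>: "\<phi> \<in> top_dual" and \<beta>: "\<beta> \<in> carrier_mat n n"
  shows "frechet_mat n (map_mat \<phi>) \<beta> (map_mat \<phi>)"
  unfolding frechet_mat_def
proof (intro conjI allI impI)
  from \<phi> obtain K where K: "\<And>x. norm (\<phi> x) \<le> norm x * K"
    by (auto simp: top_dual_def bounded_linear.bounded dest!: bounded_linear.bounded)
  show "bounded_clinear_mat n (map_mat \<phi>)"
  proof (rule bounded_clinear_matI[where K = K])
    fix h :: "'b mat" assume h: "h \<in> carrier_mat n n"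
    show "map_mat \<phi> (h + k) = map_mat \<phi> h + map_mat \<phi> k" if "k \<in> carrier_mat n n" for k
      using h that by (intro eq_matI) (auto simp: top_dual_add[OF \<phi>])
    show "map_mat \<phi> (complex_scalar_mat c h) = c \<cdot>\<^sub>m map_mat \<phi> h" for c
      using h by (intro eq_matI) (auto simp: complex_scalar_mat_def top_dual_scaleC[OF \<phi>])
    show "mat_norm (map_mat \<phi> h) \<le> K * mat_norm h"
      using h by (simp add: mat_norm_def sum_distrib_left)
        (intro sum_mono order_trans[OF K], simp add: mult.commute)
  qed simp
  have "mat_norm (map_mat \<phi> (\<beta> + h) - map_mat \<phi> \<beta> - map_mat \<phi> h) = 0"
    if "h \<in> carrier_mat n n" for h
    using that \<beta> by (simp add: mat_norm_def top_dual_add[OF \<phi>])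
  then show "\<exists>d>0. \<forall>h\<in>carrier_mat n n. mat_norm h < d \<longrightarrow>
      mat_norm (map_mat \<phi> (\<beta> + h) - map_mat \<phi> \<beta> - map_mat \<phi> h) \<le> e * mat_norm h" if "e > 0" for e
    using that by (auto intro!: exI[of _ 1] simp: mat_norm_nonneg)
qed

text \<open>The product rule, which also covers scalar multiples.\<close>

lemma frechet_mat_mult:
  fixes F G :: "'b::complex_banach_algebra_1 mat \<Rightarrow> complex mat"
  assumes F: "F \<in> carrier_mat n n \<rightarrow> carrier_mat n n" and G: "G \<in> carrier_mat n n \<rightarrow> carrier_mat n n"
    and \<beta>: "\<beta> \<in> carrier_mat n n"
    and L: "frechet_mat n F \<beta> L" and M: "frechet_mat n G \<beta> M"
  shows "frechet_mat n (\<lambda>\<beta>. F \<beta> * G \<beta>) \<beta> (\<lambda>h. L h * G \<beta> + F \<beta> * M h)"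
  unfolding frechet_mat_def
proof (intro conjI allI impI)
  have blL: "bounded_clinear_mat n L" and blM: "bounded_clinear_mat n M"
    using L M by (auto simp: frechet_mat_def)
  obtain K where K0: "K \<ge> 0" and K: "\<And>h. h \<in> carrier_mat n n \<Longrightarrow> mat_norm (L h) \<le> K * mat_norm h"
    using bounded_clinear_mat_bound[OF blL] by metis
  obtain J where J0: "J \<ge> 0" and J: "\<And>h. h \<in> carrier_mat n n \<Longrightarrow> mat_norm (M h) \<le> J * mat_norm h"
    using bounded_clinear_mat_bound[OF blM] by metis
  have F\<beta>: "F \<beta> \<in> carrier_mat n n" and G\<beta>: "G \<beta> \<in> carrier_mat n n"
    using F G \<beta> by auto
  note Lc = bounded_clinear_matD(1)[OF blL] and Mc = bounded_clinear_matD(1)[OF blM]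
  define a where "a = mat_norm (F \<beta>)"
  define g where "g = mat_norm (G \<beta>)"
  have a0: "a \<ge> 0" and g0: "g \<ge> 0"
    by (auto simp: a_def g_def mat_norm_nonneg)
  show "bounded_clinear_mat n (\<lambda>h. L h * G \<beta> + F \<beta> * M h)"
  proof (rule bounded_clinear_matI[where K = "K * g + a * J"])
    fix h :: "'b mat" assume h: "h \<in> carrier_mat n n"
    note Lh = Lc[OF h] and Mh = Mc[OF h]
    show "L h * G \<beta> + F \<beta> * M h \<in> carrier_mat n n"
      using Lh Mh F\<beta> G\<beta> by simp
    show "L (h + k) * G \<beta> + F \<beta> * M (h + k) = L h * G \<beta> + F \<beta> * M h + (L k * G \<beta> + F \<beta> * M k)"
      if k: "k \<in> carrier_mat n n" for k
      using Lh Mh F\<beta> G\<beta> Lc[OF k] Mc[OF k]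
      by (subst bounded_clinear_matD(2)[OF blL h k], subst bounded_clinear_matD(2)[OF blM h k])
        (auto intro!: eq_matI simp: scalar_prod_def sum.distrib algebra_simps)
    show "L (complex_scalar_mat c h) * G \<beta> + F \<beta> * M (complex_scalar_mat c h) =
        c \<cdot>\<^sub>m (L h * G \<beta> + F \<beta> * M h)" for c
      using Lh Mh F\<beta> G\<beta>
      by (auto intro!: eq_matI simp: bounded_clinear_matD(3)[OF blL h] bounded_clinear_matD(3)[OF blM h]
        scalar_prod_def sum_distrib_left algebra_simps)
    have "mat_norm (L h * G \<beta> + F \<beta> * M h) \<le> mat_norm (L h * G \<beta>) + mat_norm (F \<beta> * M h)"
      using Lh Mh F\<beta> G\<beta> by (intro mat_norm_add) auto
    also have "\<dots> \<le> mat_norm (L h) * g + a * mat_norm (M h)"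
      unfolding a_def g_def by (intro add_mono mat_norm_mult[of _ n] Lh Mh F\<beta> G\<beta>)
    also have "\<dots> \<le> (K * mat_norm h) * g + a * (J * mat_norm h)"
      by (intro add_mono mult_right_mono mult_left_mono K J h a0 g0)
    finally show "mat_norm (L h * G \<beta> + F \<beta> * M h) \<le> (K * g + a * J) * mat_norm h"
      by (simp add: algebra_simps)
  qed
  fix e :: real assume e: "e > 0"
  \<comment> \<open>With \<open>x = mat_norm h\<close> and \<open>\<eta> x\<close> a bound for the errors of \<open>F\<close> and \<open>G\<close>, the error of the product
    will be at most \<open>x * (\<eta> * (a + g + J + 1)) + x * (K * (J + 1) * x)\<close>; both brackets are made at
    most \<open>e / 2\<close>.\<close>
  define \<eta> where "\<eta> = min 1 (e / (2 * (a + g + J + 1)))"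
  have \<eta>0: "\<eta> > 0" and \<eta>1: "\<eta> \<le> 1" and \<eta>e: "\<eta> * (a + g + J + 1) \<le> e / 2"
  proof -
    have pos: "a + g + J + 1 > 0" using a0 g0 J0 by simp
    then show "\<eta> > 0" "\<eta> \<le> 1" using e by (auto simp: \<eta>_def)
    have "\<eta> \<le> e / (2 * (a + g + J + 1))" by (simp add: \<eta>_def)
    then show "\<eta> * (a + g + J + 1) \<le> e / 2" using pos by (simp add: field_simps)
  qed
  from L \<eta>0 obtain d1 where d1: "d1 > 0" "\<And>h. h \<in> carrier_mat n n \<Longrightarrow> mat_norm h < d1 \<Longrightarrow>
      mat_norm (F (\<beta> + h) - F \<beta> - L h) \<le> \<eta> * mat_norm h"
    unfolding frechet_mat_def by meson
  from M \<eta>0 obtain d2 where d2: "d2 > 0" "\<And>h. h \<in> carrier_mat n n \<Longrightarrow> mat_norm h < d2 \<Longrightarrow>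
      mat_norm (G (\<beta> + h) - G \<beta> - M h) \<le> \<eta> * mat_norm h"
    unfolding frechet_mat_def by meson
  define d where "d = min (min d1 d2) (min 1 (e / (2 * (K * (J + 1) + 1))))"
  have KJ: "K * (J + 1) \<ge> 0" using K0 J0 by simp
  have d0: "d > 0" using d1 d2 e KJ by (auto simp: d_def)
  have de: "K * (J + 1) * x \<le> e / 2" if "x < d" "x \<ge> 0" for x
  proof -
    have pos: "K * (J + 1) + 1 > 0" using KJ by linarith
    have "x \<le> e / (2 * (K * (J + 1) + 1))" using that by (simp add: d_def)
    then have "(K * (J + 1) + 1) * x \<le> e / 2" using pos by (simp add: field_simps)
    then show ?thesis using that by (simp add: algebra_simps)
  qed
  show "\<exists>d>0. \<forall>h\<in>carrier_mat n n. mat_norm h < d \<longrightarrow>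
      mat_norm (F (\<beta> + h) * G (\<beta> + h) - F \<beta> * G \<beta> - (L h * G \<beta> + F \<beta> * M h)) \<le> e * mat_norm h"
  proof (intro exI[of _ d] conjI ballI impI d0)
    fix h :: "'b mat" assume h: "h \<in> carrier_mat n n" and hd: "mat_norm h < d"
    define x where "x = mat_norm h"
    have x0: "x \<ge> 0" and x1: "x \<le> 1" and xd: "x < d" using hd by (auto simp: x_def mat_norm_nonneg d_def)
    note Lh = Lc[OF h] and Mh = Mc[OF h]
    define P where "P = F (\<beta> + h)"
    define Q where "Q = G (\<beta> + h)"
    have P: "P \<in> carrier_mat n n" and Q: "Q \<in> carrier_mat n n"
      using F G \<beta> h by (auto simp: P_def Q_def)
    define R where "R = P - F \<beta> - L h"
    define S where "S = Q - G \<beta> - M h"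
    have Rc: "R \<in> carrier_mat n n" and Sc: "S \<in> carrier_mat n n"
      using P Q F\<beta> G\<beta> Lh Mh by (auto simp: R_def S_def intro!: minus_carrier_mat)
    have R: "mat_norm R \<le> \<eta> * x" and S: "mat_norm S \<le> \<eta> * x"
      using d1(2)[OF h] d2(2)[OF h] hd by (auto simp: R_def S_def P_def Q_def x_def d_def)
    have Lx: "mat_norm (L h) \<le> K * x" and Mx: "mat_norm (M h) \<le> J * x"
      using K[OF h] J[OF h] by (auto simp: x_def)
    have MS: "mat_norm (M h + S) \<le> (J + 1) * x"
    proof -
      have "mat_norm (M h + S) \<le> J * x + \<eta> * x"
        using mat_norm_add[OF Mh Sc] Mx S by linarith
      also have "\<dots> \<le> (J + 1) * x" using mult_right_mono[OF \<eta>1 x0] by (simp add: distrib_right)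
      finally show ?thesis .
    qed
    have QG: "Q = G \<beta> + (M h + S)"
      using Q G\<beta> Mh by (intro eq_matI) (auto simp: S_def)
    have "mat_norm Q \<le> g + (J + 1) * x"
      using mat_norm_add[of "G \<beta>" n "M h + S"] G\<beta> Mh Sc MS by (simp add: QG g_def)
    also have "\<dots> \<le> g + (J + 1)" using J0 x1 by (simp add: mult_left_le)
    finally have Qn: "mat_norm Q \<le> g + J + 1" by simp
    have "P * Q - F \<beta> * G \<beta> - (L h * G \<beta> + F \<beta> * M h) = R * Q + (L h * (M h + S) + F \<beta> * S)"
      using P Q F\<beta> G\<beta> Lh Mh
      by (intro eq_matI)
        (auto simp: R_def S_def scalar_prod_def sum.distrib[symmetric] sum_subtractf[symmetric]
          algebra_simps intro!: sum.cong)
    also have "mat_norm \<dots> \<le> mat_norm (R * Q) + (mat_norm (L h * (M h + S)) + mat_norm (F \<beta> * S))"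
      using Rc Sc Q Lh Mh F\<beta>
      by (intro order_trans[OF mat_norm_add[of _ n]] add_left_mono mat_norm_add[of _ n]) auto
    also have "\<dots> \<le> mat_norm R * mat_norm Q + (mat_norm (L h) * mat_norm (M h + S) + a * mat_norm S)"
      using Rc Sc Q Lh Mh F\<beta> unfolding a_def
      by (intro add_mono mat_norm_mult[of _ n]) auto
    also have "\<dots> \<le> (\<eta> * x) * (g + J + 1) + ((K * x) * ((J + 1) * x) + a * (\<eta> * x))"
      using \<eta>0 x0 K0 a0 by (intro add_mono mult_mono R Qn Lx MS S mat_norm_nonneg) auto
    also have "\<dots> = x * (\<eta> * (a + g + J + 1)) + x * (K * (J + 1) * x)"
      by (simp add: algebra_simps)
    also have "\<dots> \<le> x * (e / 2) + x * (e / 2)"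
      by (intro add_mono mult_left_mono \<eta>e de x0 xd)
    finally show "mat_norm (F (\<beta> + h) * G (\<beta> + h) - F \<beta> * G \<beta> - (L h * G \<beta> + F \<beta> * M h)) \<le> e * mat_norm h"
      by (simp add: P_def Q_def x_def)
  qed
qed

lemma frechet_mat_add:
  fixes F G :: "'b::complex_banach_algebra_1 mat \<Rightarrow> complex mat"
  assumes F: "F \<in> carrier_mat n n \<rightarrow> carrier_mat n n" and G: "G \<in> carrier_mat n n \<rightarrow> carrier_mat n n"
    and \<beta>: "\<beta> \<in> carrier_mat n n"
    and L: "frechet_mat n F \<beta> L" and M: "frechet_mat n G \<beta> M"
  shows "frechet_mat n (\<lambda>\<beta>. F \<beta> + G \<beta>) \<beta> (\<lambda>h. L h + M h)"
  unfolding frechet_mat_def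
proof (intro conjI allI impI)
  have blL: "bounded_clinear_mat n L" and blM: "bounded_clinear_mat n M"
    using L M by (auto simp: frechet_mat_def)
  obtain K where K: "\<And>h. h \<in> carrier_mat n n \<Longrightarrow> mat_norm (L h) \<le> K * mat_norm h"
    using bounded_clinear_mat_bound[OF blL] by metis
  obtain J where J: "\<And>h. h \<in> carrier_mat n n \<Longrightarrow> mat_norm (M h) \<le> J * mat_norm h"
    using bounded_clinear_mat_bound[OF blM] by metis
  note Lc = bounded_clinear_matD(1)[OF blL] and Mc = bounded_clinear_matD(1)[OF blM]
  show "bounded_clinear_mat n (\<lambda>h. L h + M h)"
  proof (rule bounded_clinear_matI[where K = "K + J"])
    fix h :: "'b mat" assume h: "h \<in> carrier_mat n n"
    note Lh = Lc[OF h] and Mh = Mc[OF h]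
    show "L h + M h \<in> carrier_mat n n"
      using Lh Mh by simp
    show "L (h + k) + M (h + k) = L h + M h + (L k + M k)" if k: "k \<in> carrier_mat n n" for k
      using Lh Mh Lc[OF k] Mc[OF k]
      by (subst bounded_clinear_matD(2)[OF blL h k], subst bounded_clinear_matD(2)[OF blM h k])
        (auto intro!: eq_matI)
    show "L (complex_scalar_mat c h) + M (complex_scalar_mat c h) = c \<cdot>\<^sub>m (L h + M h)" for c
      using Lh Mh
      by (auto intro!: eq_matI simp: bounded_clinear_matD(3)[OF blL h] bounded_clinear_matD(3)[OF blM h]
        algebra_simps)
    show "mat_norm (L h + M h) \<le> (K + J) * mat_norm h"
      using mat_norm_add[OF Lh Mh] K[OF h] J[OF h] by (simp add: algebra_simps)
  qed
  fix e :: real assume e: "e > 0"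
  then have e2: "e / 2 > 0" by simp
  from L e2 obtain d1 where d1: "d1 > 0" "\<And>h. h \<in> carrier_mat n n \<Longrightarrow> mat_norm h < d1 \<Longrightarrow>
      mat_norm (F (\<beta> + h) - F \<beta> - L h) \<le> e / 2 * mat_norm h"
    unfolding frechet_mat_def by meson
  from M e2 obtain d2 where d2: "d2 > 0" "\<And>h. h \<in> carrier_mat n n \<Longrightarrow> mat_norm h < d2 \<Longrightarrow>
      mat_norm (G (\<beta> + h) - G \<beta> - M h) \<le> e / 2 * mat_norm h"
    unfolding frechet_mat_def by meson
  show "\<exists>d>0. \<forall>h\<in>carrier_mat n n. mat_norm h < d \<longrightarrow>
      mat_norm (F (\<beta> + h) + G (\<beta> + h) - (F \<beta> + G \<beta>) - (L h + M h)) \<le> e * mat_norm h"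
  proof (intro exI[of _ "min d1 d2"] conjI ballI impI)
    fix h :: "'b mat" assume h: "h \<in> carrier_mat n n" and hd: "mat_norm h < min d1 d2"
    have c: "F (\<beta> + h) \<in> carrier_mat n n" "G (\<beta> + h) \<in> carrier_mat n n"
      "F \<beta> \<in> carrier_mat n n" "G \<beta> \<in> carrier_mat n n"
      using F G \<beta> h by auto
    have "F (\<beta> + h) + G (\<beta> + h) - (F \<beta> + G \<beta>) - (L h + M h) =
        (F (\<beta> + h) - F \<beta> - L h) + (G (\<beta> + h) - G \<beta> - M h)"
      using c Lc[OF h] Mc[OF h] by (intro eq_matI) auto
    also have "mat_norm \<dots> \<le> mat_norm (F (\<beta> + h) - F \<beta> - L h) + mat_norm (G (\<beta> + h) - G \<beta> - M h)"
      using c Lc[OF h] Mc[OF h] by (intro mat_norm_add[of _ n] minus_carrier_mat) auto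
    finally show "mat_norm (F (\<beta> + h) + G (\<beta> + h) - (F \<beta> + G \<beta>) - (L h + M h)) \<le> e * mat_norm h"
      using d1(2)[OF h] d2(2)[OF h] hd by simp
  qed (use d1 d2 in auto)
qed

text \<open>Hence the analytic families are a subalgebra, and contain the generators \<open>zmap \<phi>\<close>.\<close>

lemma mat_dsum_carrier:
  "A \<in> carrier_mat m m \<Longrightarrow> C \<in> carrier_mat n n \<Longrightarrow> mat_dsum A C \<in> carrier_mat (m + n) (m + n)"
  by (simp add: mat_dsum_def)

lemma analytic_mat_cong:
  assumes "\<And>\<beta>. \<beta> \<in> carrier_mat n n \<Longrightarrow> F \<beta> = G \<beta>"
  shows "analytic_mat n F \<longleftrightarrow> analytic_mat n G"
  unfolding analytic_mat_def using assms by simp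

lemma mk_family_in_AM:
  assumes F: "\<And>n \<beta>. n \<ge> 1 \<Longrightarrow> \<beta> \<in> carrier_mat n n \<Longrightarrow> F n \<beta> \<in> carrier_mat n n"
    and diff: "\<And>n \<beta>. n \<ge> 1 \<Longrightarrow> \<beta> \<in> carrier_mat n n \<Longrightarrow> \<exists>L. frechet_mat n (F n) \<beta> L"
    and dsum: "\<And>m n \<beta> \<beta>'. m \<ge> 1 \<Longrightarrow> n \<ge> 1 \<Longrightarrow> \<beta> \<in> carrier_mat m m \<Longrightarrow> \<beta>' \<in> carrier_mat n n \<Longrightarrow>
      F (m + n) (mat_dsum \<beta> \<beta>') = mat_dsum (F m \<beta>) (F n \<beta>')"
    and sim: "\<And>n s t \<beta>. n \<ge> 1 \<Longrightarrow> s \<in> carrier_mat n n \<Longrightarrow> t \<in> carrier_mat n n \<Longrightarrow>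
      s * t = 1\<^sub>m n \<Longrightarrow> t * s = 1\<^sub>m n \<Longrightarrow> \<beta> \<in> carrier_mat n n \<Longrightarrow>
      F n (amplify s * \<beta> * amplify t) = s * F n \<beta> * t"
  shows "mk_family F \<in> AM"
  unfolding AM_def
proof (intro CollectI conjI allI ballI impI)
  show "mk_family F \<in> families"
    by (rule mk_family_in_families) (rule F)
  fix n :: nat assume n: "n \<ge> 1"
  have "analytic_mat n (mk_family F n) \<longleftrightarrow> analytic_mat n (F n)"
    by (rule analytic_mat_cong) (use n in simp)
  then show "analytic_mat n (mk_family F n)"
    using diff[OF n] by (simp add: analytic_mat_iff)
next
  fix m n :: nat and \<beta> \<beta>' :: "'a mat"
  assume mn: "m \<ge> 1" "n \<ge> 1" "\<beta> \<in> carrier_mat m m" "\<beta>' \<in> carrier_mat n n"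
  show "mk_family F (m + n) (mat_dsum \<beta> \<beta>') = mat_dsum (mk_family F m \<beta>) (mk_family F n \<beta>')"
    using mn mat_dsum_carrier[OF mn(3,4)] dsum[OF mn] by simp
next
  fix n :: nat and s t :: "complex mat" and \<beta> :: "'a mat"
  assume *: "n \<ge> 1" "s \<in> carrier_mat n n" "t \<in> carrier_mat n n" "\<beta> \<in> carrier_mat n n"
    and inv: "inverts_mat s t \<and> inverts_mat t s"
  have "amplify s * \<beta> * amplify t \<in> carrier_mat n n"
    using * by (simp add: amplify_def)
  moreover have "s * t = 1\<^sub>m n" "t * s = 1\<^sub>m n"
    using inv * by (auto simp: inverts_mat_def)
  ultimately show "mk_family F n (amplify s * \<beta> * amplify t) = s * mk_family F n \<beta> * t"
    using * sim by simp
qed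

lemma AM_D:
  assumes "f \<in> AM"
  shows "n \<ge> 1 \<Longrightarrow> \<beta> \<in> carrier_mat n n \<Longrightarrow> f n \<beta> \<in> carrier_mat n n"
    and "n \<ge> 1 \<Longrightarrow> \<beta> \<in> carrier_mat n n \<Longrightarrow> \<exists>L. frechet_mat n (f n) \<beta> L"
    and "m \<ge> 1 \<Longrightarrow> n \<ge> 1 \<Longrightarrow> \<beta> \<in> carrier_mat m m \<Longrightarrow> \<beta>' \<in> carrier_mat n n \<Longrightarrow>
      f (m + n) (mat_dsum \<beta> \<beta>') = mat_dsum (f m \<beta>) (f n \<beta>')"
    and "n \<ge> 1 \<Longrightarrow> s \<in> carrier_mat n n \<Longrightarrow> t \<in> carrier_mat n n \<Longrightarrow>
      s * t = 1\<^sub>m n \<Longrightarrow> t * s = 1\<^sub>m n \<Longrightarrow> \<beta> \<in> carrier_mat n n \<Longrightarrow>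
      f n (amplify s * \<beta> * amplify t) = s * f n \<beta> * t"
  using assms by (auto simp: AM_def analytic_mat_iff inverts_mat_def families_carrier)

lemma mat_dsum_add:
  fixes A C :: "complex mat"
  assumes "A \<in> carrier_mat m m" "A' \<in> carrier_mat m m" "C \<in> carrier_mat n n" "C' \<in> carrier_mat n n"
  shows "mat_dsum A C + mat_dsum A' C' = mat_dsum (A + A') (C + C')"
  using assms by (intro eq_matI) (auto simp: mat_dsum_def)

lemma mat_dsum_mult:
  fixes A C :: "complex mat"
  assumes "A \<in> carrier_mat m m" "A' \<in> carrier_mat m m" "C \<in> carrier_mat n n" "C' \<in> carrier_mat n n"
  shows "mat_dsum A C * mat_dsum A' C' = mat_dsum (A * A') (C * C')"
  using assms unfolding mat_dsum_def
  by (subst mult_four_block_mat[of _ m m _ n _ n _ _ m _ n]) auto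

lemma fam_one_in_AM: "fam_one \<in> AM"
  unfolding fam_one_def
proof (rule mk_family_in_AM)
  show "\<exists>L. frechet_mat n (\<lambda>\<beta>. 1\<^sub>m n) \<beta> L" for n and \<beta> :: "'a mat"
    using frechet_mat_const[of "1\<^sub>m n" n \<beta>] by auto
  show "1\<^sub>m (m + n) = mat_dsum (1\<^sub>m m) (1\<^sub>m n)" for m n
    by (intro eq_matI) (auto simp: mat_dsum_def)
qed auto

lemma fam_add_in_AM:
  assumes f: "f \<in> AM" and g: "g \<in> AM"
  shows "fam_add f g \<in> AM"
  unfolding fam_add_def
proof (rule mk_family_in_AM, goal_cases)
  case (2 n \<beta>)
  then show ?case
    using AM_D(2)[OF f 2] AM_D(2)[OF g 2] frechet_mat_add[of "f n" n "g n"] AM_D(1)[OF f] AM_D(1)[OF g]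
    by blast
next
  case (4 n s t \<beta>)
  then show ?case
    using AM_D(1)[OF f 4(1,6)] AM_D(1)[OF g 4(1,6)] AM_D(4)[OF f 4] AM_D(4)[OF g 4]
    by (simp add: mult_add_distrib_mat[of _ n n] add_mult_distrib_mat[of _ n n])
next
  case (3 m n \<beta> \<beta>')
  then show ?case
    by (simp add: AM_D(3)[OF f] AM_D(3)[OF g] mat_dsum_add[of _ m _ _ n] AM_D(1)[OF f] AM_D(1)[OF g])
qed (simp_all add: AM_D(1)[OF f] AM_D(1)[OF g])

lemma fam_mult_in_AM:
  assumes f: "f \<in> AM" and g: "g \<in> AM"
  shows "fam_mult f g \<in> AM"
  unfolding fam_mult_def
proof (rule mk_family_in_AM, goal_cases)
  case (1 n \<beta>)
  then show ?case
    using AM_D(1)[OF f 1] AM_D(1)[OF g 1] by simp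
next
  case (2 n \<beta>)
  then show ?case
    using AM_D(2)[OF f 2] AM_D(2)[OF g 2] frechet_mat_mult[of "f n" n "g n"] AM_D(1)[OF f] AM_D(1)[OF g]
    by blast
next
  case (3 m n \<beta> \<beta>')
  then show ?case
    by (simp add: AM_D(3)[OF f] AM_D(3)[OF g] mat_dsum_mult[of _ m _ _ n] AM_D(1)[OF f] AM_D(1)[OF g])
next
  case (4 n s t \<beta>)
  let ?a = "f n \<beta>" and ?c = "g n \<beta>"
  have a: "?a \<in> carrier_mat n n" and c: "?c \<in> carrier_mat n n"
    using AM_D(1)[OF f 4(1,6)] AM_D(1)[OF g 4(1,6)] .
  have "(s * ?a * t) * (s * ?c * t) = s * ?a * (t * s) * (?c * t)"
    using a c 4(2,3) by (simp add: assoc_mult_mat[of _ n n _ n _ n])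
  also have "\<dots> = s * ?a * 1\<^sub>m n * (?c * t)"
    by (simp only: 4)
  also have "\<dots> = s * (?a * ?c) * t"
    using a c 4(2,3) by (simp add: assoc_mult_mat[of _ n n _ n _ n])
  finally show ?case
    by (simp only: AM_D(4)[OF f 4] AM_D(4)[OF g 4])
qed

lemma fam_scale_in_AM:
  assumes f: "f \<in> AM"
  shows "fam_scale c f \<in> AM"
  unfolding fam_scale_def
proof (rule mk_family_in_AM, goal_cases)
  case (2 n \<beta>)
  let ?C = "c \<cdot>\<^sub>m 1\<^sub>m n"
  from AM_D(2)[OF f 2] obtain L where L: "frechet_mat n (f n) \<beta> L" by blast
  have fc: "f n \<in> carrier_mat n n \<rightarrow> carrier_mat n n"
    using AM_D(1)[OF f 2(1)] by blast
  have "frechet_mat n (\<lambda>\<beta>. ?C * f n \<beta>) \<beta> (\<lambda>h. 0\<^sub>m n n * f n \<beta> + ?C * L h)"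
    by (rule frechet_mat_mult[OF _ fc 2(2) frechet_mat_const L]) auto
  moreover have "?C * f n \<beta> = c \<cdot>\<^sub>m f n \<beta>" if "\<beta> \<in> carrier_mat n n" for \<beta>
    using AM_D(1)[OF f 2(1) that] by (simp add: mult_smult_assoc_mat[of _ n n _ n])
  ultimately have "frechet_mat n (\<lambda>\<beta>. c \<cdot>\<^sub>m f n \<beta>) \<beta> (\<lambda>h. 0\<^sub>m n n * f n \<beta> + ?C * L h)"
    using 2 by (simp add: frechet_mat_def)
  then show ?case by blast
next
  case (3 m n \<beta> \<beta>')
  then show ?case
    using AM_D(1)[OF f 3(1,3)] AM_D(1)[OF f 3(2,4)]
    unfolding AM_D(3)[OF f 3] by (intro eq_matI) (auto simp: mat_dsum_def)
next
  case (4 n s t \<beta>)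
  then show ?case
    using AM_D(1)[OF f 4(1,6)]
    by (simp add: AM_D(4)[OF f 4] mult_smult_distrib[of _ n n _ n] mult_smult_assoc_mat[of _ n n _ n])
qed (simp_all add: AM_D(1)[OF f])

lemma zmap_in_AM:
  assumes \<phi>: "\<phi> \<in> top_dual"
  shows "zmap \<phi> \<in> AM"
  unfolding zmap_def
proof (rule mk_family_in_AM, goal_cases)
  case (2 n \<beta>)
  then show ?case using frechet_mat_functional[OF \<phi>] by blast
next
  case (3 m n \<beta> \<beta>')
  then show ?case by (intro eq_matI) (auto simp: mat_dsum_def top_dual_zero[OF \<phi>])
next
  case (4 n s t \<beta>)
  then show ?case
    by (intro eq_matI)
      (simp_all add: amplify_def scalar_prod_def top_dual_sum[OF \<phi>] top_dual_scaleC[OF \<phi>]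
        mult_scaleC_left mult_scaleC_right sum_distrib_right ac_simps)
qed simp


section \<open>Generated subalgebras and alternating monomials\<close>

text \<open>The complex linear span of a nonempty set. No clause for \<open>0\<close> is needed, as \<open>scale 0 x = 0\<close>.\<close>

inductive_set cspan :: "'b mfam set \<Rightarrow> 'b mfam set" for X where
  base: "x \<in> X \<Longrightarrow> x \<in> cspan X"
| add: "x \<in> cspan X \<Longrightarrow> y \<in> cspan X \<Longrightarrow> x + y \<in> cspan X"
| scale: "x \<in> cspan X \<Longrightarrow> scale c x \<in> cspan X"

lemma cspan_mult:
  assumes X: "\<And>x y. x \<in> X \<Longrightarrow> y \<in> X \<Longrightarrow> x * y \<in> X"
    and x: "x \<in> cspan X" and y: "y \<in> cspan X"
  shows "x * y \<in> cspan X"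
  using x
proof induction
  case (base x)
  from y show ?case
    by induction
      (use X base in \<open>auto simp: distrib_left scale_mult_right intro: cspan.intros\<close>)
qed (auto simp: distrib_right scale_mult_left intro: cspan.intros)

text \<open>The unital complex algebra generated by a set.\<close>

inductive_set subalg :: "'b mfam set \<Rightarrow> 'b mfam set" for X where
  one: "1 \<in> subalg X"
| base: "x \<in> X \<Longrightarrow> x \<in> subalg X"
| add: "x \<in> subalg X \<Longrightarrow> y \<in> subalg X \<Longrightarrow> x + y \<in> subalg X"
| scale: "x \<in> subalg X \<Longrightarrow> scale c x \<in> subalg X"
| mult: "x \<in> subalg X \<Longrightarrow> y \<in> subalg X \<Longrightarrow> x * y \<in> subalg X"

lemma subalg_subset_cspan:
  assumes "G \<subseteq> cspan X" "1 \<in> X" "\<And>x y. x \<in> X \<Longrightarrow> y \<in> X \<Longrightarrow> x * y \<in> X"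
  shows "subalg G \<subseteq> cspan X"
proof
  fix x assume "x \<in> subalg G"
  then show "x \<in> cspan X"
    by induction (use assms cspan_mult[of X] in \<open>auto intro: cspan.intros\<close>)
qed

lemma cspan_subset_subalg:
  assumes "X \<subseteq> subalg G"
  shows "cspan X \<subseteq> subalg G"
proof
  fix x assume "x \<in> cspan X"
  then show "x \<in> subalg G"
    by induction (use assms in \<open>auto intro: subalg.intros\<close>)
qed

lemma subalg_mono: "X \<subseteq> Y \<Longrightarrow> subalg X \<subseteq> subalg Y"
proof
  fix x assume "X \<subseteq> Y" "x \<in> subalg X"
  from this(2,1) show "x \<in> subalg Y"
    by induction (auto intro: subalg.intros)
qed

lemma subalg_uminus: "x \<in> subalg X \<Longrightarrow> - x \<in> subalg X"
  using subalg.scale[of x X "- 1"] by (simp add: scale_minus_one)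

lemma subalg_diff: "x \<in> subalg X \<Longrightarrow> y \<in> subalg X \<Longrightarrow> x - y \<in> subalg X"
  using subalg.add[OF _ subalg_uminus, of x X y] by simp

text \<open>The intersection of subalgebras of \<open>AM\<close> agrees with the inductive description, because \<open>AM\<close> is
  itself closed under the algebra operations.\<close>

lemma generated_subalgebra_eq:
  fixes X :: "'b::complex_banach_algebra_1 mfam set"
  assumes X: "Rep_mfam ` X \<subseteq> AM"
  shows "generated_subalgebra (Rep_mfam ` X) = Rep_mfam ` subalg X"
proof (rule antisym)
  have "Rep_mfam x \<in> AM" if "x \<in> subalg X" for x
    using that
    by induction
      (use X in \<open>auto simp: one_mfam.rep_eq plus_mfam.rep_eq times_mfam.rep_eq scale.rep_eq
        fam_one_in_AM fam_add_in_AM fam_mult_in_AM fam_scale_in_AM\<close>)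
  then have "unital_subalgebra (Rep_mfam ` subalg X)"
    unfolding unital_subalgebra_def
    by (auto simp flip: one_mfam.rep_eq plus_mfam.rep_eq times_mfam.rep_eq scale.rep_eq
      intro!: imageI intro: subalg.intros)
  moreover have "Rep_mfam ` X \<subseteq> Rep_mfam ` subalg X"
    by (auto intro: subalg.base)
  ultimately show "generated_subalgebra (Rep_mfam ` X) \<subseteq> Rep_mfam ` subalg X"
    unfolding generated_subalgebra_def by blast
next
  have "Rep_mfam x \<in> S" if "x \<in> subalg X" and S: "unital_subalgebra S" "Rep_mfam ` X \<subseteq> S" for x S
    using that(1)
    by induction
      (use S in \<open>auto simp: unital_subalgebra_def one_mfam.rep_eq plus_mfam.rep_eq times_mfam.rep_eq
        scale.rep_eq\<close>)
  then show "Rep_mfam ` subalg X \<subseteq> generated_subalgebra (Rep_mfam ` X)"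
    unfolding generated_subalgebra_def by blast
qed

text \<open>The evaluations \<open>zmap \<phi>\<close>, the algebra \<open>zalg\<close> generated by all of them, and the subalgebra \<open>zperp\<close>
  generated by those with \<open>\<phi> 1 = 0\<close>.\<close>

lift_definition zgen :: "('b \<Rightarrow> complex) \<Rightarrow> 'b mfam" is zmap
  by (rule fam_ops_in_families)

lemma entry_zgen:
  "n \<ge> 1 \<Longrightarrow> \<beta> \<in> carrier_mat n n \<Longrightarrow> i < n \<Longrightarrow> j < n \<Longrightarrow> entry (zgen \<phi>) n \<beta> i j = \<phi> (\<beta> $$ (i, j))"
  by (simp add: entry_def zgen.rep_eq zmap_def)

definition zalg :: "'b::complex_banach_algebra_1 mfam set" where
  "zalg = subalg {zgen \<phi> | \<phi>. \<phi> \<in> top_dual}"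

definition zperp :: "'b::complex_banach_algebra_1 mfam set" where
  "zperp = subalg {zgen \<phi> | \<phi>. \<phi> \<in> top_dual \<and> \<phi> 1 = 0}"

lemma Z_dual_eq: "(Z_dual :: 'b::complex_banach_algebra_1 family set) = Rep_mfam ` zalg"
  and Z_perp_eq: "(Z_perp :: 'b family set) = Rep_mfam ` zperp"
proof -
  have gen: "generated_subalgebra {zmap \<phi> | \<phi>. P \<phi>} = Rep_mfam ` subalg {zgen \<phi> | \<phi>. P \<phi>}"
    if "\<And>\<phi>. P \<phi> \<Longrightarrow> \<phi> \<in> top_dual" for P :: "('b \<Rightarrow> complex) \<Rightarrow> bool"
  proof -
    have "{zmap \<phi> | \<phi>. P \<phi>} = Rep_mfam ` {zgen \<phi> | \<phi>. P \<phi>}"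
      by (force simp: zgen.rep_eq)
    moreover have "Rep_mfam ` {zgen \<phi> | \<phi>. P \<phi>} \<subseteq> AM"
      using that by (auto simp: zgen.rep_eq zmap_in_AM)
    ultimately show ?thesis
      using generated_subalgebra_eq by simp
  qed
  show "(Z_dual :: 'b family set) = Rep_mfam ` zalg" "(Z_perp :: 'b family set) = Rep_mfam ` zperp"
    unfolding Z_dual_def Z_perp_def zalg_def zperp_def
    using gen[of "\<lambda>\<phi>. \<phi> \<in> top_dual"] gen[of "\<lambda>\<phi>. \<phi> \<in> top_dual \<and> \<phi> 1 = 0"] by blast+
qed

lemma zperp_subset_zalg: "zperp \<subseteq> zalg"
  unfolding zalg_def zperp_def by (rule subalg_mono) auto

lemma zalg_closed:
  "1 \<in> zalg" "\<phi> \<in> top_dual \<Longrightarrow> zgen \<phi> \<in> zalg"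
  "x \<in> zalg \<Longrightarrow> y \<in> zalg \<Longrightarrow> x + y \<in> zalg"
  "x \<in> zalg \<Longrightarrow> y \<in> zalg \<Longrightarrow> x - y \<in> zalg"
  "x \<in> zalg \<Longrightarrow> y \<in> zalg \<Longrightarrow> x * y \<in> zalg"
  "x \<in> zalg \<Longrightarrow> scale c x \<in> zalg"
  unfolding zalg_def by (auto intro: subalg.intros subalg_diff)

lemma zalg_zero: "0 \<in> zalg"
  using zalg_closed(6)[OF zalg_closed(1), of 0] by simp

text \<open>The words in the generators are closed under products, so they span \<open>zalg\<close>.\<close>

lemma zalg_word_induct [consumes 1, case_names word add scale]:
  assumes "f \<in> zalg"
    and word: "\<And>\<phi>s. set \<phi>s \<subseteq> top_dual \<Longrightarrow> P (prod_list (map zgen \<phi>s))"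
    and add: "\<And>f g. f \<in> zalg \<Longrightarrow> g \<in> zalg \<Longrightarrow> P f \<Longrightarrow> P g \<Longrightarrow> P (f + g)"
    and scale: "\<And>c f. f \<in> zalg \<Longrightarrow> P f \<Longrightarrow> P (scale c f)"
  shows "P f"
proof -
  let ?X = "{prod_list (map zgen \<phi>s) | \<phi>s. set \<phi>s \<subseteq> (top_dual :: ('a \<Rightarrow> complex) set)}"
  have wz: "prod_list (map zgen \<phi>s) \<in> zalg" if "set \<phi>s \<subseteq> top_dual" for \<phi>s :: "('a \<Rightarrow> complex) list"
    using that by (induction \<phi>s) (auto intro: zalg_closed)
  have sub: "cspan ?X \<subseteq> zalg"
    using wz unfolding zalg_def by (intro cspan_subset_subalg) auto
  have "zalg \<subseteq> cspan ?X"
    unfolding zalg_def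
  proof (rule subalg_subset_cspan)
    show "{zgen \<phi> |\<phi>. \<phi> \<in> top_dual} \<subseteq> cspan ?X"
    proof clarify
      fix \<phi> :: "'a \<Rightarrow> complex" assume "\<phi> \<in> top_dual"
      then show "zgen \<phi> \<in> cspan ?X"
        by (intro cspan.base CollectI exI[of _ "[\<phi>]"]) simp
    qed
    show "1 \<in> ?X" by (auto intro: exI[of _ "[]"])
    show "x * y \<in> ?X" if xy: "x \<in> ?X" "y \<in> ?X" for x y
    proof -
      from xy obtain us vs where "x = prod_list (map zgen us)" "y = prod_list (map zgen vs)"
        "set us \<subseteq> top_dual" "set vs \<subseteq> top_dual" by auto
      then show ?thesis by (auto intro!: exI[of _ "us @ vs"])
    qed
  qed
  with \<open>f \<in> zalg\<close> have "f \<in> cspan ?X" by blast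
  then show ?thesis
    by induction (use word add scale sub in \<open>blast+\<close>)
qed

text \<open>\<open>alt_prod t [c\<^sub>0, \<dots>, c\<^sub>n]\<close> is \<open>c\<^sub>0 t c\<^sub>1 \<cdots> t c\<^sub>n\<close>. With \<open>t = zgen \<theta>\<close> these are the monomials
  \<open>theta_monomial\<close>.\<close>

fun alt_prod :: "'a::monoid_mult \<Rightarrow> 'a list \<Rightarrow> 'a" where
  "alt_prod t [] = 1"
| "alt_prod t [c] = c"
| "alt_prod t (c # d # cs) = c * t * alt_prod t (d # cs)"

lemma alt_prod_Cons: "cs \<noteq> [] \<Longrightarrow> alt_prod t (c # cs) = c * t * alt_prod t cs"
  by (cases cs) auto

lemma alt_prod_append:
  "cs \<noteq> [] \<Longrightarrow> ds \<noteq> [] \<Longrightarrow> alt_prod t (cs @ ds) = alt_prod t cs * t * alt_prod t ds"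
  by (induction t cs rule: alt_prod.induct) (auto simp: alt_prod_Cons mult.assoc)

lemma alt_prod_mult_last: "alt_prod t (cs @ [c]) * d = alt_prod t (cs @ [c * d])"
  by (cases "cs = []") (simp_all add: alt_prod_append mult.assoc)

lemma alt_prod_mult:
  "alt_prod t (cs @ [c]) * alt_prod t (d # ds) = alt_prod t (cs @ (c * d) # ds)"
proof (cases "ds = []")
  case False
  then show ?thesis
    using alt_prod_append[of "cs @ [c * d]" ds t]
    by (simp add: alt_prod_Cons alt_prod_mult_last flip: mult.assoc)
qed (simp add: alt_prod_mult_last)

lemma theta_monomial_eq:
  "theta_monomial \<theta> (map Rep_mfam cs) = Rep_mfam (alt_prod (zgen \<theta>) cs)"
  by (induction "zgen \<theta>" cs rule: alt_prod.induct)
    (simp_all add: one_mfam.rep_eq times_mfam.rep_eq zgen.rep_eq)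

lemma top_dual_lin:
  assumes "\<phi> \<in> top_dual" "\<psi> \<in> top_dual"
  shows "(\<lambda>x. \<phi> x - c * \<psi> x) \<in> top_dual"
  using assms
  by (auto simp: top_dual_def algebra_simps intro!: bounded_linear_sub bounded_linear_const_mult)

lemma alt_prod_in_zalg:
  assumes "\<theta> \<in> top_dual" "set cs \<subseteq> zalg"
  shows "alt_prod (zgen \<theta>) cs \<in> zalg"
  using assms(2)
  by (induction "zgen \<theta>" cs rule: alt_prod.induct) (auto intro!: zalg_closed assms(1))

text \<open>The monomials alternating between \<open>zperp\<close> and \<open>zgen \<theta>\<close> span \<open>zalg\<close>: a product of two of them merges
  the adjacent factors from \<open>zperp\<close>, and a generator splits as
  \<open>zgen \<phi> = zgen (\<phi> - \<phi> 1 \<theta>) + \<phi> 1 zgen \<theta>\<close>.\<close>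

lemma zalg_alt_induct [consumes 3, case_names alt add scale]:
  assumes \<theta>: "\<theta> \<in> top_dual" "\<theta> 1 = 1" and "f \<in> zalg"
    and alt: "\<And>cs. cs \<noteq> [] \<Longrightarrow> set cs \<subseteq> zperp \<Longrightarrow> P (alt_prod (zgen \<theta>) cs)"
    and add: "\<And>f g. f \<in> zalg \<Longrightarrow> g \<in> zalg \<Longrightarrow> P f \<Longrightarrow> P g \<Longrightarrow> P (f + g)"
    and scale: "\<And>c f. f \<in> zalg \<Longrightarrow> P f \<Longrightarrow> P (scale c f)"
  shows "P f"
proof -
  let ?X = "{alt_prod (zgen \<theta>) cs | cs. cs \<noteq> [] \<and> set cs \<subseteq> zperp}"
  have X: "alt_prod (zgen \<theta>) cs \<in> ?X" if "cs \<noteq> []" "set cs \<subseteq> zperp" for cs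
    using that by blast
  have one: "1 \<in> zperp"
    unfolding zperp_def by (rule subalg.one)
  have sub: "cspan ?X \<subseteq> zalg"
    unfolding zalg_def
    by (intro cspan_subset_subalg, fold zalg_def)
      (use zperp_subset_zalg in \<open>auto intro!: alt_prod_in_zalg \<theta>(1)\<close>)
  have "zalg \<subseteq> cspan ?X"
    unfolding zalg_def
  proof (rule subalg_subset_cspan)
    show "{zgen \<phi> |\<phi>. \<phi> \<in> top_dual} \<subseteq> cspan ?X"
    proof clarify
      fix \<phi> :: "'a \<Rightarrow> complex" assume \<phi>: "\<phi> \<in> top_dual"
      define \<psi> where "\<psi> = (\<lambda>x. \<phi> x - \<phi> 1 * \<theta> x)"
      have "zgen \<psi> \<in> zperp"
        unfolding zperp_def using top_dual_lin[OF \<phi> \<theta>(1), of "\<phi> 1"] \<theta>(2)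
        by (auto intro!: subalg.base simp: \<psi>_def)
      then have "alt_prod (zgen \<theta>) [zgen \<psi>] + scale (\<phi> 1) (alt_prod (zgen \<theta>) [1, 1]) \<in> cspan ?X"
        using one by (intro cspan.intros X) auto
      also have "alt_prod (zgen \<theta>) [zgen \<psi>] + scale (\<phi> 1) (alt_prod (zgen \<theta>) [1, 1]) = zgen \<phi>"
        by (rule mfam_eqI) (simp add: entry_simps entry_zgen \<psi>_def)
      finally show "zgen \<phi> \<in> cspan ?X" .
    qed
    show "1 \<in> ?X" using X[of "[1]"] one by simp
    show "x * y \<in> ?X" if xy: "x \<in> ?X" "y \<in> ?X" for x y
    proof -
      from xy obtain us vs where "x = alt_prod (zgen \<theta>) us" "y = alt_prod (zgen \<theta>) vs"
        "us \<noteq> []" "vs \<noteq> []" "set us \<subseteq> zperp" "set vs \<subseteq> zperp" by auto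
      moreover from this obtain cs c d ds where "us = cs @ [c]" "vs = d # ds"
        by (metis neq_Nil_conv rev_exhaust)
      moreover have "c * d \<in> zperp" if "c \<in> zperp" "d \<in> zperp"
        using that unfolding zperp_def by (rule subalg.mult)
      ultimately show ?thesis
        using X[of "cs @ (c * d) # ds"] by (simp add: alt_prod_mult)
    qed
  qed
  with \<open>f \<in> zalg\<close> have "f \<in> cspan ?X" by blast
  then show ?thesis
    by induction (use alt add scale sub in \<open>blast+\<close>)
qed


section \<open>Elements of the algebra as multilinear forms\<close>

text \<open>The strictly upper triangular matrix with the list \<open>w\<close> on the first superdiagonal.\<close>

definition superdiag :: "'b::zero list \<Rightarrow> 'b mat" where
  "superdiag w = mat (Suc (length w)) (Suc (length w)) (\<lambda>(i, j). if j = Suc i then w ! i else 0)"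

lemma superdiag_carrier [simp]: "superdiag w \<in> carrier_mat (Suc (length w)) (Suc (length w))"
  by (simp add: superdiag_def)

text \<open>The coefficient function of \<open>f\<close>. By \<open>coef_one\<close> and \<open>coef_zgen_mult\<close>, the coefficients of the word
  \<open>z(\<phi>\<^sub>1) \<cdots> z(\<phi>\<^sub>k)\<close> are \<open>\<phi>\<^sub>1 (w\<^sub>1) \<cdots> \<phi>\<^sub>k (w\<^sub>k)\<close> on lists \<open>w\<close> of length \<open>k\<close> and \<open>0\<close> on other
  lists, so \<open>coef\<close> identifies \<open>zalg\<close> with the tensor algebra of the dual of \<open>B\<close>, realised by
  multilinear forms.\<close>

definition coef :: "'b::zero mfam \<Rightarrow> 'b list \<Rightarrow> complex" where
  "coef f w = entry f (Suc (length w)) (superdiag w) 0 (length w)"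

lemma coef_add: "coef (f + g) w = coef f w + coef g w"
  and coef_diff: "coef (f - g) w = coef f w - coef g w"
  and coef_scale: "coef (scale c f) w = c * coef f w"
  and coef_one: "coef 1 w = (if w = [] then 1 else 0)"
  by (simp_all add: coef_def entry_simps)

lemma coef_zgen:
  assumes "\<phi> \<in> top_dual"
  shows "coef (zgen \<phi>) w = (if length w = 1 then \<phi> (hd w) else 0)"
  by (cases w) (auto simp: coef_def entry_zgen superdiag_def top_dual_zero[OF assms])

text \<open>The other entries at a superdiagonal matrix are coefficients at sublists of consecutive elements.
  This is what makes \<open>coef\<close> multiplicative for the deconcatenation product of \<open>coef_mult\<close>.\<close>

lemma entry_superdiag:
  assumes "f \<in> zalg" "i \<le> length w" "j \<le> length w"
  shows "entry f (Suc (length w)) (superdiag w) i j =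
    (if i \<le> j then coef f (take (j - i) (drop i w)) else 0)"
  using assms unfolding zalg_def
proof (induction f arbitrary: w i j)
  case one
  then show ?case by (auto simp: entry_simps coef_one)
next
  case (base x)
  then obtain \<phi> where \<phi>: "\<phi> \<in> top_dual" "x = zgen \<phi>" by auto
  with base show ?case
    by (auto simp: entry_zgen coef_zgen superdiag_def top_dual_zero[OF \<phi>(1)] hd_drop_conv_nth)
next
  case (add x y)
  then show ?case by (simp add: entry_simps coef_add)
next
  case (scale x c)
  then show ?case by (simp add: entry_simps coef_scale)
next
  case (mult x y)
  let ?n = "Suc (length w)"
  let ?F = "\<lambda>e. if i \<le> e \<and> e \<le> j then coef x (take (e - i) (drop i w)) * coef y (take (j - e) (drop e w))
    else 0"
  have lhs: "entry (x * y) ?n (superdiag w) i j = (\<Sum>e<?n. ?F e)"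
    using mult.prems mult.IH(1)[of i w] mult.IH(2)[of _ w j]
    by (subst entry_mult) (auto intro!: sum.cong)
  show ?case
  proof (cases "i \<le> j")
    case False
    then show ?thesis unfolding lhs by (intro trans[OF sum.neutral]) auto
  next
    case True
    define u where "u = take (j - i) (drop i w)"
    have len: "length u = j - i" using mult.prems by (simp add: u_def)
    have "coef (x * y) u = (\<Sum>e<Suc (length u). coef x (take e u) * coef y (take (length u - e) (drop e u)))"
      unfolding coef_def[of "x * y"]
      using mult.IH(1)[of 0 u] mult.IH(2)[of _ u "length u"]
      by (subst entry_mult) (auto intro!: sum.cong)
    also have "\<dots> = (\<Sum>e<Suc (j - i). ?F (e + i))"
      using mult.prems True unfolding len
      by (intro sum.cong) (auto simp: u_def drop_take min_def add.commute)
    also have "\<dots> = (\<Sum>e\<in>{i..j}. ?F e)"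
      using True by (intro sum.reindex_bij_witness[of _ "\<lambda>e. e - i" "\<lambda>e. e + i"]) auto
    also have "\<dots> = (\<Sum>e<?n. ?F e)"
      using mult.prems by (intro sum.mono_neutral_left) auto
    finally show ?thesis
      unfolding lhs using True by (simp add: u_def)
  qed
qed

lemma coef_mult:
  assumes "f \<in> zalg" "g \<in> zalg"
  shows "coef (f * g) w = (\<Sum>e\<le>length w. coef f (take e w) * coef g (drop e w))"
proof -
  have "coef (f * g) w = (\<Sum>e<Suc (length w). coef f (take e w) * coef g (drop e w))"
    unfolding coef_def[of "f * g"]
    using entry_superdiag[OF assms(1), of 0 w] entry_superdiag[OF assms(2), of _ w "length w"]
    by (subst entry_mult) (auto intro!: sum.cong)
  then show ?thesis by (simp only: lessThan_Suc_atMost)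
qed

lemma coef_zgen_mult:
  assumes "\<phi> \<in> top_dual" "f \<in> zalg"
  shows "coef (zgen \<phi> * f) w = (if w = [] then 0 else \<phi> (hd w) * coef f (tl w))"
proof (cases w)
  case Nil
  then show ?thesis by (simp add: coef_mult zalg_closed assms coef_zgen)
next
  case (Cons b bs)
  have "coef (zgen \<phi> * f) w = (\<Sum>e\<in>{1}. coef (zgen \<phi>) (take e w) * coef f (drop e w))"
    unfolding coef_mult[OF zalg_closed(2)[OF assms(1)] assms(2)]
    by (rule sum.mono_neutral_right) (auto simp: Cons coef_zgen assms)
  then show ?thesis by (simp add: Cons coef_zgen assms)
qed

text \<open>The sum of \<open>G\<close> over all paths of \<open>k\<close> steps from \<open>a\<close> to \<open>c\<close> in \<open>{0..<n}\<close>, where \<open>G\<close> is applied to the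
  list of entries of \<open>\<beta>\<close> along the path.\<close>

fun path_sum :: "nat \<Rightarrow> 'b mat \<Rightarrow> nat \<Rightarrow> ('b list \<Rightarrow> complex) \<Rightarrow> nat \<Rightarrow> nat \<Rightarrow> complex" where
  "path_sum n \<beta> 0 G a c = (if a = c then G [] else 0)"
| "path_sum n \<beta> (Suc k) G a c = (\<Sum>e<n. path_sum n \<beta> k (\<lambda>w. G (\<beta> $$ (a, e) # w)) e c)"

lemma path_sum_add:
  "path_sum n \<beta> k (\<lambda>w. G w + H w) a c = path_sum n \<beta> k G a c + path_sum n \<beta> k H a c"
  by (induction k arbitrary: G H a) (simp_all add: sum.distrib)

lemma path_sum_mult: "path_sum n \<beta> k (\<lambda>w. r * G w) a c = r * path_sum n \<beta> k G a c"
  by (induction k arbitrary: G a) (simp_all add: sum_distrib_left)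

lemma path_sum_zero: "path_sum n \<beta> k (\<lambda>w. 0) a c = 0"
  by (induction k arbitrary: a) simp_all

lemma path_sum_word:
  assumes "set \<phi>s \<subseteq> top_dual" "n \<ge> 1" "\<beta> \<in> carrier_mat n n" "a < n" "c < n"
  shows "path_sum n \<beta> k (coef (prod_list (map zgen \<phi>s))) a c =
    (if k = length \<phi>s then entry (prod_list (map zgen \<phi>s)) n \<beta> a c else 0)"
  using assms
proof (induction \<phi>s arbitrary: k a)
  case Nil
  then show ?case
    by (cases k) (simp_all add: coef_one entry_simps path_sum_zero)
next
  case (Cons \<phi> \<phi>s)
  have wz: "prod_list (map zgen \<phi>s) \<in> zalg"
    using Cons.prems(1) by (induction \<phi>s) (auto intro: zalg_closed)
  from Cons show ?case
    by (cases k) (auto simp: coef_zgen_mult wz path_sum_mult entry_simps entry_zgen)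
qed

text \<open>Every element of \<open>zalg\<close> is recovered from its coefficients; those at long lists vanish, so the
  sums become stationary.\<close>

lemma entry_eq_path_sum:
  assumes "f \<in> zalg"
  shows "\<forall>\<^sub>F N in sequentially. \<forall>n\<ge>1. \<forall>\<beta>\<in>carrier_mat n n. \<forall>a<n. \<forall>c<n.
    entry f n \<beta> a c = (\<Sum>k<N. path_sum n \<beta> k (coef f) a c)"
  using assms
proof (induction rule: zalg_word_induct)
  case (word \<phi>s)
  show ?case
    using eventually_gt_at_top[of "length \<phi>s"]
    by eventually_elim (simp add: path_sum_word[OF word])
next
  case (add f g)
  from add.IH show ?case
    by eventually_elim (simp add: coef_add entry_simps path_sum_add sum.distrib)
next
  case (scale c f)
  from scale.IH show ?case
    by eventually_elim (simp add: coef_scale entry_simps path_sum_mult sum_distrib_left)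
qed

text \<open>This is the freeness statement on which the existence of the rotation map rests.\<close>

lemma coef_inject:
  assumes "f \<in> zalg" "g \<in> zalg" and eq: "\<And>w. coef f w = coef g w"
  shows "f = g"
proof -
  have "f - g \<in> zalg" using assms by (intro zalg_closed)
  from eventually_happens'[OF sequentially_bot entry_eq_path_sum[OF this]] obtain K where
    K: "\<forall>n\<ge>1. \<forall>\<beta>\<in>carrier_mat n n. \<forall>a<n. \<forall>c<n.
      entry (f - g) n \<beta> a c = (\<Sum>k<K. path_sum n \<beta> k (coef (f - g)) a c)" ..
  have "coef (f - g) = (\<lambda>w. 0)"
    using eq by (auto simp: coef_diff)
  then have "f - g = 0"
    using K by (intro mfam_eqI) (simp add: path_sum_zero entry_zero)
  then show ?thesis by simp
qed


section \<open>The rotation map\<close>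

lemma coef_mult_zgen_mult:
  assumes \<theta>: "\<theta> \<in> top_dual" and f: "f \<in> zalg" and g: "g \<in> zalg"
  shows "coef (f * zgen \<theta> * g) w =
    (\<Sum>i<length w. coef f (take i w) * (\<theta> (w ! i) * coef g (drop (Suc i) w)))"
proof -
  have "coef (f * (zgen \<theta> * g)) w =
      (\<Sum>e<Suc (length w). coef f (take e w) * coef (zgen \<theta> * g) (drop e w))"
    using coef_mult[OF f zalg_closed(5)[OF zalg_closed(2)[OF \<theta>] g]]
    by (simp only: lessThan_Suc_atMost)
  also have "\<dots> = (\<Sum>i<length w. coef f (take i w) * (\<theta> (w ! i) * coef g (drop (Suc i) w)))"
    by (auto simp: coef_zgen_mult[OF \<theta> g] hd_drop_conv_nth drop_Suc tl_drop intro!: sum.cong)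
  finally show ?thesis by (simp add: mult.assoc)
qed

text \<open>The projection to the kernel of \<open>\<theta>\<close> along \<open>1\<close>, when \<open>\<theta> 1 = 1\<close>.\<close>

definition proj :: "('b \<Rightarrow> complex) \<Rightarrow> 'b::complex_banach_algebra_1 \<Rightarrow> 'b" where
  "proj \<theta> b = b - \<theta> b *\<^sub>C 1"

lemma top_dual_proj: "\<phi> \<in> top_dual \<Longrightarrow> \<phi> (proj \<theta> b) = \<phi> b - \<theta> b * \<phi> 1"
  by (simp add: proj_def top_dual_diff top_dual_scaleC)

text \<open>Coefficients of elements of \<open>zperp\<close> ignore the multiples of \<open>1\<close> in their arguments.\<close>

lemma coef_zperp_proj:
  assumes "c \<in> zperp"
  shows "coef c (map (proj \<theta>) w) = coef c w"
  using assms unfolding zperp_def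
proof (induction arbitrary: w)
  case (base x)
  then show ?case by (cases w) (auto simp: coef_zgen top_dual_proj)
next
  case (mult x y)
  have "x \<in> zalg" "y \<in> zalg"
    using mult.hyps zperp_subset_zalg unfolding zperp_def by auto
  then show ?case
    by (simp add: coef_mult take_map drop_map mult.IH)
qed (simp_all add: coef_one coef_add coef_scale)

lemma coef_zperp_unit:
  assumes "c \<in> zperp" "1 \<in> set w"
  shows "coef c w = 0"
  using assms unfolding zperp_def
proof (induction arbitrary: w)
  case (base x)
  then show ?case by (cases w) (auto simp: coef_zgen)
next
  case (mult x y)
  have xy: "x \<in> zalg" "y \<in> zalg"
    using mult.hyps zperp_subset_zalg unfolding zperp_def by auto
  have "1 \<in> set (take e w) \<or> 1 \<in> set (drop e w)" for e
    using mult.prems by (metis UnE append_take_drop_id set_append)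
  then have "coef x (take e w) * coef y (drop e w) = 0" for e
    using mult.IH by (metis mult_zero_left mult_zero_right)
  then show ?case
    unfolding coef_mult[OF xy] by (rule sum.neutral[OF ballI])
qed (auto simp: coef_one coef_add coef_scale)

text \<open>The rotation on coefficients. On a list \<open>v\<^sub>0 @ [1] @ v\<^sub>1 @ \<dots> @ [1] @ v\<^sub>n\<close> with all \<open>v\<^sub>i\<close> in the kernel of
  \<open>\<theta>\<close>, the monomial \<open>c\<^sub>0 z(\<theta>) c\<^sub>1 \<cdots> z(\<theta>) c\<^sub>n\<close> has coefficient
  \<open>coef c\<^sub>0 v\<^sub>0 \<cdots> coef c\<^sub>n v\<^sub>n\<close>. Rotating the factors thus amounts to moving the last block \<open>v\<^sub>n\<close>, with
  the preceding \<open>1\<close> behind it, to the front. The definition extends this multilinearly, by writing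
  each \<open>b\<close> as \<open>proj \<theta> b + \<theta> b \<cdot> 1\<close>: the index \<open>i\<close> is the last position where the multiple of \<open>1\<close> is
  taken, and the first summand is the case without such a position.\<close>

definition rot_coef :: "('b \<Rightarrow> complex) \<Rightarrow> ('b::complex_banach_algebra_1 list \<Rightarrow> complex) \<Rightarrow>
    'b list \<Rightarrow> complex" where
  "rot_coef \<theta> G w = G (map (proj \<theta>) w) +
     (\<Sum>i<length w. \<theta> (w ! i) * G (map (proj \<theta>) (drop (Suc i) w) @ 1 # take i w))"

lemma rot_coef_add:
  "rot_coef \<theta> (coef (f + g)) w = rot_coef \<theta> (coef f) w + rot_coef \<theta> (coef g) w"
  by (simp add: rot_coef_def coef_add sum.distrib algebra_simps)

lemma rot_coef_scale: "rot_coef \<theta> (coef (scale c f)) w = c * rot_coef \<theta> (coef f) w"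
  by (simp add: rot_coef_def coef_scale sum_distrib_left algebra_simps)

context
  fixes \<theta> :: "'b::complex_banach_algebra_1 \<Rightarrow> complex"
  assumes \<theta>: "\<theta> \<in> top_dual" and \<theta>1: "\<theta> 1 = 1"
begin

lemma rot_coef_perp:
  assumes c: "c \<in> zperp"
  shows "rot_coef \<theta> (coef c) = coef c"
  by (rule ext) (simp add: rot_coef_def coef_zperp_proj[OF c] coef_zperp_unit[OF c])

lemma rot_coef_split:
  assumes c: "c \<in> zperp" and g: "g \<in> zalg"
  shows "rot_coef \<theta> (coef (c * zgen \<theta> * g)) = coef (g * zgen \<theta> * c)"
proof (rule ext)
  fix w :: "'b list"
  have cz: "c \<in> zalg" using c zperp_subset_zalg by auto
  note F = coef_mult_zgen_mult[OF \<theta> cz g] and R = coef_mult_zgen_mult[OF \<theta> g cz]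
  have P: "\<theta> (proj \<theta> b) = 0" for b
    by (simp add: top_dual_proj[OF \<theta>] \<theta>1)
  have 0: "coef (c * zgen \<theta> * g) (map (proj \<theta>) w) = 0"
    unfolding F by (rule sum.neutral) (simp add: P)
  \<comment> \<open>In the sum for a product, \<open>\<theta>\<close> kills the terms before the inserted \<open>1\<close>, and \<open>c\<close> those after it.\<close>
  have 1: "coef (c * zgen \<theta> * g) (map (proj \<theta>) v @ 1 # u) = coef c v * coef g u" for u v
  proof -
    let ?w = "map (proj \<theta>) v @ 1 # u"
    have "coef (c * zgen \<theta> * g) ?w =
        (\<Sum>i\<in>{length v}. coef c (take i ?w) * (\<theta> (?w ! i) * coef g (drop (Suc i) ?w)))"
      unfolding F
    proof (rule sum.mono_neutral_right)
      show "\<forall>i\<in>{..<length ?w} - {length v}.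
          coef c (take i ?w) * (\<theta> (?w ! i) * coef g (drop (Suc i) ?w)) = 0"
      proof
        fix i assume "i \<in> {..<length ?w} - {length v}"
        then consider "i < length v" | "i > length v" by force
        then show "coef c (take i ?w) * (\<theta> (?w ! i) * coef g (drop (Suc i) ?w)) = 0"
        proof cases
          case 1
          then show ?thesis by (simp add: nth_append P)
        next
          case 2
          then have "1 \<in> set (take i ?w)" by (simp add: take_Cons')
          then show ?thesis using coef_zperp_unit[OF c] by simp
        qed
      qed
    qed auto
    then show ?thesis by (simp add: nth_append \<theta>1 coef_zperp_proj[OF c])
  qed
  show "rot_coef \<theta> (coef (c * zgen \<theta> * g)) w = coef (g * zgen \<theta> * c) w"
    unfolding rot_coef_def 0 1 R by (simp add: algebra_simps)
qed

lemma rot_coef_alt_prod: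
  assumes "cs \<noteq> []" "set cs \<subseteq> zperp"
  shows "rot_coef \<theta> (coef (alt_prod (zgen \<theta>) cs)) = coef (alt_prod (zgen \<theta>) (rotate1 cs))"
proof -
  obtain c ds where cs: "cs = c # ds" using assms by (cases cs) auto
  have c: "c \<in> zperp" and ds: "set ds \<subseteq> zalg"
    using assms zperp_subset_zalg by (auto simp: cs)
  show ?thesis
  proof (cases "ds = []")
    case True
    then show ?thesis by (simp add: cs rot_coef_perp[OF c])
  next
    case False
    then show ?thesis
      using rot_coef_split[OF c alt_prod_in_zalg[OF \<theta> ds]]
      by (simp add: cs alt_prod_Cons alt_prod_append)
  qed
qed

lemma ex_rot:
  assumes "f \<in> zalg"
  shows "\<exists>g\<in>zalg. coef g = rot_coef \<theta> (coef f)"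
  using \<theta> \<theta>1 assms
proof (induction rule: zalg_alt_induct)
  case (alt cs)
  then have "alt_prod (zgen \<theta>) (rotate1 cs) \<in> zalg"
    using zperp_subset_zalg by (intro alt_prod_in_zalg[OF \<theta>]) auto
  then show ?case
    using rot_coef_alt_prod[OF alt] by force
next
  case (add f g)
  then obtain f' g' where "f' \<in> zalg" "g' \<in> zalg"
    "coef f' = rot_coef \<theta> (coef f)" "coef g' = rot_coef \<theta> (coef g)" by blast
  moreover from this have "coef (f' + g') w = rot_coef \<theta> (coef (f + g)) w" for w
    unfolding rot_coef_add by (simp add: coef_add)
  ultimately show ?case
    by (intro bexI[of _ "f' + g'"] ext zalg_closed)
next
  case (scale c f)
  then obtain f' where "f' \<in> zalg" "coef f' = rot_coef \<theta> (coef f)" by blast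
  moreover from this have "coef (scale c f') w = rot_coef \<theta> (coef (scale c f)) w" for w
    unfolding rot_coef_scale by (simp add: coef_scale)
  ultimately show ?case
    by (intro bexI[of _ "scale c f'"] ext zalg_closed)
qed

end

text \<open>The rotation map on \<open>zalg\<close>; the chosen element is unique by \<open>coef_inject\<close>.\<close>

definition rot :: "('b \<Rightarrow> complex) \<Rightarrow> 'b::complex_banach_algebra_1 mfam \<Rightarrow> 'b mfam" where
  "rot \<theta> f = (SOME g. g \<in> zalg \<and> coef g = rot_coef \<theta> (coef f))"

context
  fixes \<theta> :: "'b::complex_banach_algebra_1 \<Rightarrow> complex"
  assumes \<theta>: "\<theta> \<in> top_dual" and \<theta>1: "\<theta> 1 = 1"
begin

lemma rot_in_zalg: "f \<in> zalg \<Longrightarrow> rot \<theta> f \<in> zalg"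
  and coef_rot: "f \<in> zalg \<Longrightarrow> coef (rot \<theta> f) = rot_coef \<theta> (coef f)"
  using someI_ex[of "\<lambda>g. g \<in> zalg \<and> coef g = rot_coef \<theta> (coef f)"] ex_rot[OF \<theta> \<theta>1, of f]
  unfolding rot_def by blast+

lemma rot_add:
  assumes "f \<in> zalg" "g \<in> zalg"
  shows "rot \<theta> (f + g) = rot \<theta> f + rot \<theta> g"
  using assms
  by (intro coef_inject) (simp_all add: coef_rot coef_add rot_coef_add rot_in_zalg zalg_closed)

lemma rot_scale:
  assumes "f \<in> zalg"
  shows "rot \<theta> (scale c f) = scale c (rot \<theta> f)"
  using assms
  by (intro coef_inject) (simp_all add: coef_rot coef_scale rot_coef_scale rot_in_zalg zalg_closed)

lemma rot_alt_prod:
  assumes "cs \<noteq> []" "set cs \<subseteq> zperp"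
  shows "rot \<theta> (alt_prod (zgen \<theta>) cs) = alt_prod (zgen \<theta>) (rotate1 cs)"
proof -
  have "alt_prod (zgen \<theta>) cs \<in> zalg" "alt_prod (zgen \<theta>) (rotate1 cs) \<in> zalg"
    using assms zperp_subset_zalg by (auto intro!: alt_prod_in_zalg[OF \<theta>])
  then show ?thesis
    by (intro coef_inject) (simp_all add: coef_rot rot_in_zalg rot_coef_alt_prod[OF \<theta> \<theta>1 assms])
qed

lemma rho_eq:
  assumes "f \<in> zalg"
  shows "rho \<theta> (Rep_mfam f) = Rep_mfam (rot \<theta> f)"
proof -
  define r where "r = (\<lambda>f\<in>Z_dual. Rep_mfam (rot \<theta> (Abs_mfam f)))"
  have r_Rep: "r (Rep_mfam f) = Rep_mfam (rot \<theta> f)" if "f \<in> zalg" for f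
    using that by (auto simp: r_def Z_dual_eq Rep_mfam_inverse)
  have lift: "\<exists>cs'. cs = map Rep_mfam cs' \<and> set cs' \<subseteq> zperp" if "set cs \<subseteq> Z_perp" for cs :: "'b family list"
  proof -
    have "Rep_mfam (Abs_mfam c) = c" if "c \<in> set cs" for c
      using that \<open>set cs \<subseteq> Z_perp\<close> by (auto simp: Z_perp_eq Rep_mfam_inverse)
    then have "cs = map Rep_mfam (map Abs_mfam cs)"
      by (simp add: map_idI)
    moreover have "set (map Abs_mfam cs) \<subseteq> zperp"
      using that by (auto simp: Z_perp_eq Rep_mfam_inverse)
    ultimately show ?thesis by blast
  qed
  have r: "is_rotation \<theta> r"
    unfolding is_rotation_def
  proof (intro conjI allI ballI impI)
    show "r \<in> Z_dual \<rightarrow>\<^sub>E Z_dual"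
      by (auto simp: r_Rep Z_dual_eq rot_in_zalg) (auto simp: r_def Z_dual_eq)
    fix f g :: "'b family" and c assume "f \<in> Z_dual"
    then obtain f' where f': "f = Rep_mfam f'" "f' \<in> zalg" by (auto simp: Z_dual_eq)
    show "r (fam_scale c f) = fam_scale c (r f)"
      using f' by (simp add: r_Rep rot_scale zalg_closed flip: scale.rep_eq)
    assume "g \<in> Z_dual"
    then obtain g' where g': "g = Rep_mfam g'" "g' \<in> zalg" by (auto simp: Z_dual_eq)
    show "r (fam_add f g) = fam_add (r f) (r g)"
      using f' g' by (simp add: r_Rep rot_add zalg_closed flip: plus_mfam.rep_eq)
  next
    fix cs :: "'b family list" assume cs: "cs \<noteq> [] \<and> set cs \<subseteq> Z_perp"
    with lift obtain ds where ds: "cs = map Rep_mfam ds" "set ds \<subseteq> zperp" by blast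
    moreover have "alt_prod (zgen \<theta>) ds \<in> zalg"
      using ds zperp_subset_zalg by (intro alt_prod_in_zalg[OF \<theta>]) auto
    ultimately show "r (theta_monomial \<theta> cs) = theta_monomial \<theta> (rotate1 cs)"
      using cs by (simp add: rotate1_map theta_monomial_eq r_Rep rot_alt_prod)
  qed
  have "rho \<theta> = r"
    unfolding rho_def
  proof (rule the_equality, rule r)
    fix r' assume r': "is_rotation \<theta> r'"
    have "r' (Rep_mfam f) = Rep_mfam (rot \<theta> f)" if "f \<in> zalg" for f
      using \<theta> \<theta>1 that
    proof (induction rule: zalg_alt_induct)
      case (alt cs)
      have "set (map Rep_mfam cs) \<subseteq> Z_perp"
        using alt by (auto simp: Z_perp_eq)
      then have "r' (theta_monomial \<theta> (map Rep_mfam cs)) = theta_monomial \<theta> (rotate1 (map Rep_mfam cs))"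
        using r' alt unfolding is_rotation_def by blast
      then show ?case
        using alt by (simp add: rotate1_map theta_monomial_eq rot_alt_prod)
    next
      case (add f g)
      then have "r' (fam_add (Rep_mfam f) (Rep_mfam g)) = fam_add (r' (Rep_mfam f)) (r' (Rep_mfam g))"
        using r' unfolding is_rotation_def Z_dual_eq by blast
      then show ?case
        using add by (simp add: rot_add flip: plus_mfam.rep_eq)
    next
      case (scale c f)
      then have "r' (fam_scale c (Rep_mfam f)) = fam_scale c (r' (Rep_mfam f))"
        using r' unfolding is_rotation_def Z_dual_eq by blast
      then show ?case
        using scale by (simp add: rot_scale flip: scale.rep_eq)
    qed
    then have "r' f = r f" if "f \<in> Z_dual" for f
      using that by (auto simp: Z_dual_eq r_Rep)
    moreover have "r' \<in> Z_dual \<rightarrow>\<^sub>E Z_dual" "r \<in> Z_dual \<rightarrow>\<^sub>E Z_dual"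
      using r r' by (auto simp: is_rotation_def)
    ultimately show "r' = r"
      by (metis PiE_ext)
  qed
  then show ?thesis
    using r_Rep[OF assms] by simp
qed

end


section \<open>The cyclic derivative\<close>

text \<open>The argument at which \<open>free_diff\<close> differentiates, and the form that \<open>f\<close> takes there: block upper
  triangular, with a corner linear in \<open>\<epsilon>\<close>. Then \<open>X\<close> holds the coefficients of the free difference
  quotient.\<close>

definition corner_mat ::
    "nat \<Rightarrow> nat \<Rightarrow> 'b::complex_banach_algebra_1 mat \<Rightarrow> 'b mat \<Rightarrow> nat \<Rightarrow> nat \<Rightarrow> complex \<Rightarrow> 'b mat" where
  "corner_mat m n \<beta> \<beta>' b c \<epsilon> =
     four_block_mat \<beta> (amplify (\<epsilon> \<cdot>\<^sub>m mat_unit m n b c)) (0\<^sub>m n m) \<beta>'"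

definition corner_form :: "'b::complex_banach_algebra_1 mfam \<Rightarrow> nat \<Rightarrow> nat \<Rightarrow> 'b mat \<Rightarrow> 'b mat \<Rightarrow>
    nat \<Rightarrow> nat \<Rightarrow> (nat \<Rightarrow> nat \<Rightarrow> complex) \<Rightarrow> bool" where
  "corner_form f m n \<beta> \<beta>' b c X \<longleftrightarrow> (\<forall>\<epsilon>. \<forall>i<m + n. \<forall>j<m + n.
     entry f (m + n) (corner_mat m n \<beta> \<beta>' b c \<epsilon>) i j =
       (if i < m then if j < m then entry f m \<beta> i j else \<epsilon> * X i (j - m)
        else if j < m then 0 else entry f n \<beta>' (i - m) (j - m)))"

lemma sum_lessThan_add:
  fixes g :: "nat \<Rightarrow> 'a::comm_monoid_add"
  shows "(\<Sum>e<m + n. g e) = (\<Sum>e<m. g e) + (\<Sum>e<n. g (m + e))"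
  by (induction n) (simp_all add: ac_simps)

context
  fixes m n :: nat and \<beta> \<beta>' :: "'b::complex_banach_algebra_1 mat" and b c :: nat
  assumes mn: "m \<ge> 1" "n \<ge> 1" and \<beta>: "\<beta> \<in> carrier_mat m m" and \<beta>': "\<beta>' \<in> carrier_mat n n"
begin

lemma corner_mat_carrier: "corner_mat m n \<beta> \<beta>' b c \<epsilon> \<in> carrier_mat (m + n) (m + n)"
  using \<beta> \<beta>' by (simp add: corner_mat_def)

lemma free_diff_corner_form:
  assumes X: "corner_form f m n \<beta> \<beta>' b c X" and "a < m" "d < n"
  shows "free_diff (Rep_mfam f) m n \<beta> \<beta>' a b c d = X a d"
proof -
  have "(\<lambda>\<epsilon>. Rep_mfam f (m + n) (corner_mat m n \<beta> \<beta>' b c \<epsilon>) $$ (a, m + d)) = (\<lambda>\<epsilon>. \<epsilon> * X a d)"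
    using assms unfolding corner_form_def entry_def by auto
  moreover have "((\<lambda>\<epsilon>. \<epsilon> * X a d) has_field_derivative X a d) (at 0)"
    by (auto intro!: derivative_eq_intros)
  ultimately show ?thesis
    unfolding free_diff_def corner_mat_def by (simp add: DERIV_imp_deriv)
qed

lemma corner_form_one: "corner_form 1 m n \<beta> \<beta>' b c (\<lambda>_ _. 0)"
  using mn \<beta> \<beta>' corner_mat_carrier by (auto simp: corner_form_def entry_one)

lemma corner_form_zgen:
  assumes "\<phi> \<in> top_dual"
  shows "corner_form (zgen \<phi>) m n \<beta> \<beta>' b c (\<lambda>a d. if a = b \<and> d = c then \<phi> 1 else 0)"
  unfolding corner_form_def
proof (intro allI impI)
  fix \<epsilon> i j assume ij: "i < m + n" "j < m + n"
  have "corner_mat m n \<beta> \<beta>' b c \<epsilon> $$ (i, j) =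
      (if i < m then if j < m then \<beta> $$ (i, j)
         else (\<epsilon> * (if i = b \<and> j - m = c then 1 else 0)) *\<^sub>C 1
       else if j < m then 0 else \<beta>' $$ (i - m, j - m))"
    using ij \<beta> \<beta>' by (auto simp: corner_mat_def amplify_def mat_unit_def)
  then show "entry (zgen \<phi>) (m + n) (corner_mat m n \<beta> \<beta>' b c \<epsilon>) i j =
     (if i < m then if j < m then entry (zgen \<phi>) m \<beta> i j
        else \<epsilon> * (if i = b \<and> j - m = c then \<phi> 1 else 0)
      else if j < m then 0 else entry (zgen \<phi>) n \<beta>' (i - m) (j - m))"
    using ij mn \<beta> \<beta>' corner_mat_carrier
    by (auto simp: entry_zgen top_dual_scaleC[OF assms] top_dual_zero[OF assms])
qed

lemma corner_form_add:
  assumes "corner_form f m n \<beta> \<beta>' b c X" "corner_form g m n \<beta> \<beta>' b c Y"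
  shows "corner_form (f + g) m n \<beta> \<beta>' b c (\<lambda>a d. X a d + Y a d)"
  using assms mn \<beta> \<beta>' corner_mat_carrier
  by (auto simp: corner_form_def entry_add algebra_simps)

lemma corner_form_scale:
  assumes "corner_form f m n \<beta> \<beta>' b c X"
  shows "corner_form (scale r f) m n \<beta> \<beta>' b c (\<lambda>a d. r * X a d)"
  using assms mn \<beta> \<beta>' corner_mat_carrier
  by (auto simp: corner_form_def entry_scale algebra_simps)

lemma corner_form_mult:
  assumes "corner_form f m n \<beta> \<beta>' b c X" "corner_form g m n \<beta> \<beta>' b c Y"
  shows "corner_form (f * g) m n \<beta> \<beta>' b c
    (\<lambda>a d. (\<Sum>e<m. entry f m \<beta> a e * Y e d) + (\<Sum>e<n. X a e * entry g n \<beta>' e d))"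
  using assms mn \<beta> \<beta>' corner_mat_carrier
  by (auto simp: corner_form_def entry_mult sum_lessThan_add distrib_left sum_distrib_left mult_ac)

lemma ex_corner_form: "f \<in> zalg \<Longrightarrow> \<exists>X. corner_form f m n \<beta> \<beta>' b c X"
  unfolding zalg_def
proof (induction rule: subalg.induct)
  case one
  show ?case using corner_form_one by blast
next
  case (base x)
  then show ?case using corner_form_zgen by blast
next
  case (add x y)
  then show ?case using corner_form_add by blast
next
  case (scale x r)
  then show ?case using corner_form_scale by blast
next
  case (mult x y)
  then show ?case using corner_form_mult by blast
qed

lemma free_diff_one:
  assumes "a < m" "d < n"
  shows "free_diff (Rep_mfam 1) m n \<beta> \<beta>' a b c d = 0"
  using free_diff_corner_form[OF corner_form_one assms] .

lemma free_diff_zgen: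
  assumes "a < m" "d < n" "\<phi> \<in> top_dual"
  shows "free_diff (Rep_mfam (zgen \<phi>)) m n \<beta> \<beta>' a b c d = (if a = b \<and> d = c then \<phi> 1 else 0)"
  using free_diff_corner_form[OF corner_form_zgen[OF assms(3)] assms(1,2)] .

lemma free_diff_add:
  assumes "a < m" "d < n" "f \<in> zalg" "g \<in> zalg"
  shows "free_diff (Rep_mfam (f + g)) m n \<beta> \<beta>' a b c d =
    free_diff (Rep_mfam f) m n \<beta> \<beta>' a b c d + free_diff (Rep_mfam g) m n \<beta> \<beta>' a b c d"
proof -
  obtain X Y where XY: "corner_form f m n \<beta> \<beta>' b c X" "corner_form g m n \<beta> \<beta>' b c Y"
    using ex_corner_form assms by blast
  show ?thesis
    using assms XY[THEN free_diff_corner_form] free_diff_corner_form[OF corner_form_add[OF XY]]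
    by simp
qed

lemma free_diff_scale:
  assumes "a < m" "d < n" "f \<in> zalg"
  shows "free_diff (Rep_mfam (scale r f)) m n \<beta> \<beta>' a b c d =
    r * free_diff (Rep_mfam f) m n \<beta> \<beta>' a b c d"
proof -
  obtain X where X: "corner_form f m n \<beta> \<beta>' b c X"
    using ex_corner_form assms by blast
  show ?thesis
    using assms free_diff_corner_form[OF X] free_diff_corner_form[OF corner_form_scale[OF X]]
    by simp
qed

text \<open>The free difference quotient is a derivation:
  \<open>\<partial>(f g) = (f \<otimes> 1) \<partial>g + \<partial>f (1 \<otimes> g)\<close>.\<close>

lemma free_diff_mult:
  assumes "a < m" "d < n" "f \<in> zalg" "g \<in> zalg"
  shows "free_diff (Rep_mfam (f * g)) m n \<beta> \<beta>' a b c d =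
    (\<Sum>e<m. entry f m \<beta> a e * free_diff (Rep_mfam g) m n \<beta> \<beta>' e b c d) +
    (\<Sum>e<n. free_diff (Rep_mfam f) m n \<beta> \<beta>' a b c e * entry g n \<beta>' e d)"
proof -
  obtain X Y where XY: "corner_form f m n \<beta> \<beta>' b c X" "corner_form g m n \<beta> \<beta>' b c Y"
    using ex_corner_form assms by blast
  show ?thesis
    using assms XY[THEN free_diff_corner_form] free_diff_corner_form[OF corner_form_mult[OF XY]]
    by simp
qed

end

text \<open>If the free difference quotient of \<open>f\<close> is a sum of tensors \<open>g \<otimes> h\<close>, then \<open>insert_deriv f u\<close> is the sum
  of the products \<open>h u g\<close>. The cyclic derivative is the case \<open>u = 1\<close>; the general \<open>u\<close> gives the simple
  product rule \<open>insert_deriv_mult\<close>.\<close>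

definition insert_deriv :: "'b::complex_banach_algebra_1 mfam \<Rightarrow> 'b mfam \<Rightarrow> 'b mfam" where
  "insert_deriv f u = Abs_mfam (mk_family (\<lambda>n \<beta>. mat n n (\<lambda>(k, l).
     \<Sum>a<n. \<Sum>d<n. free_diff (Rep_mfam f) n n \<beta> \<beta> a l k d * entry u n \<beta> d a)))"

lemma entry_insert_deriv:
  assumes "n \<ge> 1" "\<beta> \<in> carrier_mat n n" "k < n" "l < n"
  shows "entry (insert_deriv f u) n \<beta> k l =
    (\<Sum>a<n. \<Sum>d<n. free_diff (Rep_mfam f) n n \<beta> \<beta> a l k d * entry u n \<beta> d a)"
proof -
  have "mk_family (\<lambda>n \<beta>. mat n n (\<lambda>(k, l). \<Sum>a<n. \<Sum>d<n.
      free_diff (Rep_mfam f) n n \<beta> \<beta> a l k d * entry u n \<beta> d a)) \<in> families"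
    by (rule mk_family_in_families) simp
  then show ?thesis
    unfolding entry_def[of "insert_deriv f u"] unfolding insert_deriv_def
    using assms by (simp add: Abs_mfam_inverse)
qed

lemma tensor_mult_flip:
  assumes "k < n" "l < n"
  shows "tensor_mult n (tensor_flip T) $$ (k, l) = (\<Sum>a<n. T a l k a)"
proof -
  have unit: "(mat_unit n n a b * mat_unit n n c d) $$ (k, l) =
      (if k = a \<and> b = c \<and> l = d then 1 else 0 :: complex)"
    if "a < n" "b < n" "c < n" "d < n" for a b c d
  proof -
    have "(mat_unit n n a b * mat_unit n n c d) $$ (k, l) =
        (\<Sum>e<n. (if k = a \<and> e = b then 1 else 0) * (if e = c \<and> l = d then 1 else 0 :: complex))"
      using assms that by (simp add: mat_unit_def scalar_prod_def atLeast0LessThan)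
    also have "\<dots> = (\<Sum>e<n. if e = b then (if k = a \<and> b = c \<and> l = d then 1 else 0) else 0)"
      by (intro sum.cong) auto
    finally show ?thesis using that by simp
  qed
  have "tensor_mult n (tensor_flip T) $$ (k, l) =
      (\<Sum>a<n. \<Sum>b<n. \<Sum>c<n. \<Sum>d<n. T c d a b * (if k = a \<and> b = c \<and> l = d then 1 else 0))"
    using assms by (simp add: tensor_mult_def tensor_flip_def unit)
  also have "\<dots> = (\<Sum>a<n. \<Sum>b<n. \<Sum>c<n. \<Sum>d<n.
      if d = l then if c = b then if a = k then T c d a b else 0 else 0 else 0)"
    by (intro sum.cong refl) auto
  also have "\<dots> = (\<Sum>a<n. \<Sum>b<n. if a = k then T b l a b else 0)"
    using assms by simp
  also have "\<dots> = (\<Sum>b<n. \<Sum>a<n. if a = k then T b l a b else 0)"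
    by (rule sum.swap)
  also have "\<dots> = (\<Sum>b<n. T b l k b)"
    using assms by simp
  finally show ?thesis .
qed

lemma cyclic_deriv_Rep: "cyclic_deriv (Rep_mfam f) = Rep_mfam (insert_deriv f 1)"
proof (rule families_eqI[OF _ Rep_mfam])
  show "cyclic_deriv (Rep_mfam f) \<in> families"
    unfolding cyclic_deriv_def by (rule mk_family_in_families) (simp add: tensor_mult_def)
next
  fix n :: nat and \<beta> :: "'a mat" assume n: "n \<ge> 1" "\<beta> \<in> carrier_mat n n"
  show "cyclic_deriv (Rep_mfam f) n \<beta> = Rep_mfam (insert_deriv f 1) n \<beta>"
  proof (rule eq_matI)
    fix k l assume "k < dim_row (Rep_mfam (insert_deriv f 1) n \<beta>)"
      "l < dim_col (Rep_mfam (insert_deriv f 1) n \<beta>)"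
    then have kl: "k < n" "l < n"
      using Rep_mfam_carrier[OF n, of "insert_deriv f 1"] by auto
    have "Rep_mfam (insert_deriv f 1) n \<beta> $$ (k, l) =
        (\<Sum>a<n. \<Sum>d<n. free_diff (Rep_mfam f) n n \<beta> \<beta> a l k d * (if d = a then 1 else 0))"
      using entry_insert_deriv[OF n kl, of f 1] n by (simp add: entry_def[of "insert_deriv f 1"] entry_one)
    also have "\<dots> = (\<Sum>a<n. free_diff (Rep_mfam f) n n \<beta> \<beta> a l k a)"
      by (simp add: if_distrib cong: if_cong)
    finally show "cyclic_deriv (Rep_mfam f) n \<beta> $$ (k, l) = Rep_mfam (insert_deriv f 1) n \<beta> $$ (k, l)"
      using n kl by (simp add: cyclic_deriv_def tensor_mult_flip)
  qed (use Rep_mfam_carrier[OF n, of "insert_deriv f 1"] n in \<open>auto simp: cyclic_deriv_def tensor_mult_def\<close>)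
qed

lemma insert_deriv_add:
  "f \<in> zalg \<Longrightarrow> g \<in> zalg \<Longrightarrow> insert_deriv (f + g) u = insert_deriv f u + insert_deriv g u"
  by (rule mfam_eqI) (simp add: entry_insert_deriv entry_add free_diff_add distrib_right sum.distrib)

lemma insert_deriv_scale:
  "f \<in> zalg \<Longrightarrow> insert_deriv (scale r f) u = scale r (insert_deriv f u)"
  by (rule mfam_eqI) (simp add: entry_insert_deriv entry_scale free_diff_scale sum_distrib_left mult.assoc)

lemma insert_deriv_one: "insert_deriv 1 u = 0"
  by (rule mfam_eqI) (simp add: entry_insert_deriv entry_zero free_diff_one)

lemma insert_deriv_zgen:
  assumes "\<phi> \<in> top_dual"
  shows "insert_deriv (zgen \<phi>) u = scale (\<phi> 1) u"
proof (rule mfam_eqI)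
  fix n :: nat and \<beta> :: "'a mat" and k l
  assume *: "n \<ge> 1" "\<beta> \<in> carrier_mat n n" "k < n" "l < n"
  have "entry (insert_deriv (zgen \<phi>) u) n \<beta> k l =
      (\<Sum>a<n. \<Sum>d<n. (if a = l \<and> d = k then \<phi> 1 else 0) * entry u n \<beta> d a)"
    using * assms by (simp add: entry_insert_deriv free_diff_zgen)
  also have "\<dots> = (\<Sum>a<n. if a = l then \<phi> 1 * entry u n \<beta> k a else 0)"
  proof (intro sum.cong refl)
    fix a
    have "(\<Sum>d<n. (if a = l \<and> d = k then \<phi> 1 else 0) * entry u n \<beta> d a) =
        (\<Sum>d<n. if d = k then if a = l then \<phi> 1 * entry u n \<beta> d a else 0 else 0)"
      by (intro sum.cong) auto
    then show "(\<Sum>d<n. (if a = l \<and> d = k then \<phi> 1 else 0) * entry u n \<beta> d a) =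
        (if a = l then \<phi> 1 * entry u n \<beta> k a else 0)"
      using * by simp
  qed
  also have "\<dots> = entry (scale (\<phi> 1) u) n \<beta> k l"
    using * by (simp add: entry_scale)
  finally show "entry (insert_deriv (zgen \<phi>) u) n \<beta> k l = entry (scale (\<phi> 1) u) n \<beta> k l" .
qed

lemma insert_deriv_mult:
  assumes f: "f \<in> zalg" and g: "g \<in> zalg"
  shows "insert_deriv (f * g) u = insert_deriv f (g * u) + insert_deriv g (u * f)"
proof (rule mfam_eqI)
  fix n :: nat and \<beta> :: "'a mat" and k l
  assume *: "n \<ge> 1" "\<beta> \<in> carrier_mat n n" "k < n" "l < n"
  let ?F = "\<lambda>a d. free_diff (Rep_mfam f) n n \<beta> \<beta> a l k d"
  let ?G = "\<lambda>a d. free_diff (Rep_mfam g) n n \<beta> \<beta> a l k d"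
  have "entry (insert_deriv (f * g) u) n \<beta> k l =
      (\<Sum>a<n. \<Sum>d<n. ((\<Sum>e<n. entry f n \<beta> a e * ?G e d) + (\<Sum>e<n. ?F a e * entry g n \<beta> e d)) *
        entry u n \<beta> d a)"
    using * f g by (simp add: entry_insert_deriv free_diff_mult)
  also have "\<dots> = (\<Sum>a<n. \<Sum>d<n. \<Sum>e<n. ?F a e * (entry g n \<beta> e d * entry u n \<beta> d a)) +
      (\<Sum>a<n. \<Sum>d<n. \<Sum>e<n. ?G e d * (entry u n \<beta> d a * entry f n \<beta> a e))"
    by (simp add: distrib_left distrib_right sum.distrib sum_distrib_left sum_distrib_right mult_ac)
  also have "(\<Sum>a<n. \<Sum>d<n. \<Sum>e<n. ?F a e * (entry g n \<beta> e d * entry u n \<beta> d a)) =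
      (\<Sum>a<n. \<Sum>e<n. \<Sum>d<n. ?F a e * (entry g n \<beta> e d * entry u n \<beta> d a))"
    by (intro sum.cong refl sum.swap)
  also have "\<dots> = entry (insert_deriv f (g * u)) n \<beta> k l"
    using * by (simp add: entry_insert_deriv entry_mult sum_distrib_left)
  also have "(\<Sum>a<n. \<Sum>d<n. \<Sum>e<n. ?G e d * (entry u n \<beta> d a * entry f n \<beta> a e)) =
      (\<Sum>a<n. \<Sum>e<n. \<Sum>d<n. ?G e d * (entry u n \<beta> d a * entry f n \<beta> a e))"
    by (intro sum.cong refl sum.swap)
  also have "\<dots> = (\<Sum>e<n. \<Sum>a<n. \<Sum>d<n. ?G e d * (entry u n \<beta> d a * entry f n \<beta> a e))"
    by (rule sum.swap)
  also have "\<dots> = (\<Sum>e<n. \<Sum>d<n. \<Sum>a<n. ?G e d * (entry u n \<beta> d a * entry f n \<beta> a e))"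
    by (intro sum.cong refl sum.swap)
  also have "\<dots> = entry (insert_deriv g (u * f)) n \<beta> k l"
    using * by (simp add: entry_insert_deriv entry_mult sum_distrib_left)
  finally show "entry (insert_deriv (f * g) u) n \<beta> k l =
      entry (insert_deriv f (g * u) + insert_deriv g (u * f)) n \<beta> k l"
    using * by (simp add: entry_add)
qed

lemma zperp_in_zalg: "c \<in> zperp \<Longrightarrow> c \<in> zalg"
  using zperp_subset_zalg by blast

lemma insert_deriv_perp:
  assumes "c \<in> zperp"
  shows "insert_deriv c u = 0"
  using assms unfolding zperp_def
proof (induction arbitrary: u)
  case one
  show ?case by (rule insert_deriv_one)
next
  case (base x)
  then show ?case by (auto simp: insert_deriv_zgen)
next
  case (add x y)
  then show ?case by (simp add: insert_deriv_add zperp_in_zalg zperp_def)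
next
  case (scale x r)
  then show ?case by (simp add: insert_deriv_scale zperp_in_zalg zperp_def)
next
  case (mult x y)
  then show ?case by (simp add: insert_deriv_mult zperp_in_zalg zperp_def)
qed

lemma insert_deriv_cyclic:
  assumes "f \<in> zalg" "g \<in> zalg"
  shows "insert_deriv (f * g) 1 = insert_deriv (g * f) 1"
  using assms by (simp add: insert_deriv_mult add.commute)

context
  fixes \<theta> :: "'b::complex_banach_algebra_1 \<Rightarrow> complex"
  assumes \<theta>: "\<theta> \<in> top_dual" and \<theta>1: "\<theta> 1 = 1"
begin

lemma alt_prod_perp_in_zalg: "set cs \<subseteq> zperp \<Longrightarrow> alt_prod (zgen \<theta>) cs \<in> zalg"
  using zperp_subset_zalg by (intro alt_prod_in_zalg[OF \<theta>]) auto

text \<open>The factors from \<open>zperp\<close> have derivative \<open>0\<close>, and the factor \<open>zgen \<theta>\<close> before \<open>cs ! i\<close> contributes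
  the term with index \<open>i\<close>.\<close>

lemma insert_deriv_alt_prod:
  assumes "set cs \<subseteq> zperp"
  shows "insert_deriv (alt_prod (zgen \<theta>) cs) u =
    (\<Sum>i=1..<length cs. alt_prod (zgen \<theta>) (drop i cs) * u * alt_prod (zgen \<theta>) (take i cs))"
  using assms
proof (induction "zgen \<theta>" cs arbitrary: u rule: alt_prod.induct)
  case 1
  show ?case by (simp add: insert_deriv_one)
next
  case (2 c)
  then show ?case by (simp add: insert_deriv_perp)
next
  case (3 c d cs)
  let ?A = "alt_prod (zgen \<theta>)" and ?ds = "d # cs"
  have c: "c \<in> zalg" and ds: "?A ?ds \<in> zalg" and c0: "c \<in> zperp"
    using 3(2) zperp_in_zalg by (auto intro!: alt_prod_perp_in_zalg)
  have "insert_deriv (?A (c # ?ds)) u = insert_deriv (c * zgen \<theta>) (?A ?ds * u) + insert_deriv (?A ?ds) (u * (c * zgen \<theta>))"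
    using insert_deriv_mult[OF zalg_closed(5)[OF c zalg_closed(2)[OF \<theta>]] ds] by simp
  also have "insert_deriv (c * zgen \<theta>) (?A ?ds * u) = ?A ?ds * u * c"
    using insert_deriv_mult[OF c zalg_closed(2)[OF \<theta>]]
    by (simp add: insert_deriv_perp[OF c0] insert_deriv_zgen[OF \<theta>] \<theta>1)
  also have "insert_deriv (?A ?ds) (u * (c * zgen \<theta>)) =
      (\<Sum>i=1..<length ?ds. ?A (drop i ?ds) * (u * (c * zgen \<theta>)) * ?A (take i ?ds))"
    using 3 by simp
  also have "\<dots> = (\<Sum>i=1..<length ?ds. ?A (drop (Suc i) (c # ?ds)) * u * ?A (take (Suc i) (c # ?ds)))"
  proof (rule sum.cong)
    fix i assume "i \<in> {1..<length ?ds}"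
    then have "?A (take (Suc i) (c # ?ds)) = c * zgen \<theta> * ?A (take i ?ds)"
      by (simp only: take_Suc_Cons) (rule alt_prod_Cons, simp)
    then show "?A (drop i ?ds) * (u * (c * zgen \<theta>)) * ?A (take i ?ds) =
        ?A (drop (Suc i) (c # ?ds)) * u * ?A (take (Suc i) (c # ?ds))"
      by (simp add: mult.assoc)
  qed simp
  also have "\<dots> = (\<Sum>i=Suc 1..<Suc (length ?ds). ?A (drop i (c # ?ds)) * u * ?A (take i (c # ?ds)))"
    by (simp only: sum.shift_bounds_Suc_ivl)
  also have "?A ?ds * u * c + \<dots> =
      (\<Sum>i=1..<length (c # ?ds). ?A (drop i (c # ?ds)) * u * ?A (take i (c # ?ds)))"
    by (subst sum.atLeast_Suc_lessThan[of 1 "length (c # ?ds)"]) simp_all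
  finally show ?case .
qed

lemma insert_deriv_alt_prod_snoc_one:
  assumes ds: "set ds \<subseteq> zperp" "ds \<noteq> []"
  shows "insert_deriv (alt_prod (zgen \<theta>) (ds @ [1])) 1 = (\<Sum>i<length ds. alt_prod (zgen \<theta>) (rotate i ds))"
proof -
  let ?A = "alt_prod (zgen \<theta>)"
  have one: "1 \<in> zperp" unfolding zperp_def by (rule subalg.one)
  have "insert_deriv (?A (ds @ [1])) 1 =
      (\<Sum>i=1..<length (ds @ [1]). ?A (drop i (ds @ [1])) * 1 * ?A (take i (ds @ [1])))"
    by (rule insert_deriv_alt_prod) (use ds one in simp)
  also have "\<dots> = (\<Sum>i=1..<Suc (length ds). ?A (rotate i ds))"
  proof (rule sum.cong)
    fix i assume i: "i \<in> {1..<Suc (length ds)}"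
    show "?A (drop i (ds @ [1])) * 1 * ?A (take i (ds @ [1])) = ?A (rotate i ds)"
    proof (cases "i = length ds")
      case True
      then show ?thesis by simp
    next
      case False
      with i have i: "1 \<le> i" "i < length ds" by auto
      then have "?A (drop i ds @ [1]) = ?A (drop i ds) * zgen \<theta>"
        by (subst alt_prod_append) auto
      moreover have "rotate i ds = drop i ds @ take i ds"
        using i by (simp add: rotate_drop_take)
      moreover have "?A (drop i ds @ take i ds) = ?A (drop i ds) * zgen \<theta> * ?A (take i ds)"
        using i by (intro alt_prod_append) auto
      ultimately show ?thesis using i by simp
    qed
  qed simp
  also have "\<dots> = (\<Sum>i<length ds. ?A (rotate (Suc i) ds))"
    by (simp only: One_nat_def sum.shift_bounds_Suc_ivl atLeast0LessThan)
  also have "\<dots> = (\<Sum>i<length ds. ?A (rotate i ds))"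
    using sum.lessThan_Suc_shift[of "\<lambda>i. ?A (rotate i ds)" "length ds"] by simp
  finally show ?thesis .
qed

text \<open>The derivative of any monomial is a full sum of rotations of a monomial with one factor fewer: by
  \<open>insert_deriv_cyclic\<close> the last factor from \<open>zperp\<close> may be moved to the front. For a single factor
  the sum is empty.\<close>

lemma insert_deriv_alt_prod_rotations:
  assumes cs: "set cs \<subseteq> zperp" "cs \<noteq> []"
  obtains ds where "set ds \<subseteq> zperp"
    "insert_deriv (alt_prod (zgen \<theta>) cs) 1 = (\<Sum>i<length ds. alt_prod (zgen \<theta>) (rotate i ds))"
proof -
  let ?A = "alt_prod (zgen \<theta>)"
  obtain es e where es: "cs = es @ [e]" using cs(2) by (metis rev_exhaust)
  show thesis
  proof (cases es)
    case Nil
    then have "insert_deriv (?A cs) 1 = 0" using cs by (simp add: es insert_deriv_perp)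
    then show thesis by (intro that[of "[]"]) auto
  next
    case (Cons a as)
    have in_perp: "a \<in> zperp" "e \<in> zperp" "set as \<subseteq> zperp" and one: "1 \<in> zperp"
      using cs by (auto simp: es Cons zperp_def intro: subalg.one)
    then have ds: "set (e * a # as) \<subseteq> zperp"
      unfolding zperp_def by (auto intro: subalg.mult)
    have "?A (es @ [1]) \<in> zalg"
      using in_perp one by (intro alt_prod_perp_in_zalg) (auto simp: Cons)
    moreover have "e \<in> zalg" using in_perp by (intro zperp_in_zalg)
    moreover have "?A cs = ?A (es @ [1]) * e"
      by (simp add: es alt_prod_mult_last)
    ultimately have "insert_deriv (?A cs) 1 = insert_deriv (e * ?A (es @ [1])) 1"
      by (simp add: insert_deriv_cyclic)
    also have "e * ?A (es @ [1]) = ?A ((e * a # as) @ [1])"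
      using alt_prod_mult[of "zgen \<theta>" "[]" e a "as @ [1]"] by (simp add: Cons)
    finally show thesis
      using insert_deriv_alt_prod_snoc_one[OF ds] ds by (intro that[of "e * a # as"]) auto
  qed
qed

section \<open>The range of the cyclic derivative\<close>

lemma zalg_sum: "(\<And>i. i \<in> I \<Longrightarrow> f i \<in> zalg) \<Longrightarrow> (\<Sum>i\<in>I. f i) \<in> zalg"
  by (induction I rule: infinite_finite_induct) (auto intro: zalg_closed zalg_zero)

lemma insert_deriv_in_zalg:
  fixes p :: "'b mfam"
  assumes "p \<in> zalg"
  shows "insert_deriv p 1 \<in> zalg"
  using \<theta> \<theta>1 assms
proof (induction rule: zalg_alt_induct)
  case (alt cs)
  then obtain ds where "set ds \<subseteq> zperp"
    "insert_deriv (alt_prod (zgen \<theta>) cs) 1 = (\<Sum>i<length ds. alt_prod (zgen \<theta>) (rotate i ds))"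
    using insert_deriv_alt_prod_rotations by blast
  then show ?case by (auto intro!: zalg_sum alt_prod_perp_in_zalg)
qed (auto simp: insert_deriv_add insert_deriv_scale intro: zalg_closed)

lemma rot_zero: "rot \<theta> 0 = 0"
  using rot_scale[OF \<theta> \<theta>1 zalg_zero, of 0] by simp

lemma rot_sum:
  assumes "\<And>i. i \<in> I \<Longrightarrow> f i \<in> zalg"
  shows "rot \<theta> (\<Sum>i\<in>I. f i) = (\<Sum>i\<in>I. rot \<theta> (f i))"
  using assms
  by (induction I rule: infinite_finite_induct) (auto simp: rot_zero rot_add[OF \<theta> \<theta>1] zalg_sum)

lemma rot_insert_deriv:
  assumes "p \<in> zalg"
  shows "rot \<theta> (insert_deriv p 1) = insert_deriv p 1"
  using \<theta> \<theta>1 assms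
proof (induction rule: zalg_alt_induct)
  case (alt cs)
  let ?A = "alt_prod (zgen \<theta>)"
  from alt obtain ds where ds: "set ds \<subseteq> zperp"
    and eq: "insert_deriv (?A cs) 1 = (\<Sum>i<length ds. ?A (rotate i ds))"
    using insert_deriv_alt_prod_rotations by blast
  have "rot \<theta> (\<Sum>i<length ds. ?A (rotate i ds)) = (\<Sum>i<length ds. rot \<theta> (?A (rotate i ds)))"
    using ds by (intro rot_sum alt_prod_perp_in_zalg) auto
  also have "\<dots> = (\<Sum>i<length ds. ?A (rotate (Suc i) ds))"
    using ds by (intro sum.cong refl) (subst rot_alt_prod[OF \<theta> \<theta>1]; auto)
  also have "\<dots> = (\<Sum>i<length ds. ?A (rotate i ds))"
    using sum.lessThan_Suc_shift[of "\<lambda>i. ?A (rotate i ds)" "length ds"] by simp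
  finally show ?case by (simp only: eq)
qed (simp_all add: insert_deriv_add insert_deriv_scale insert_deriv_in_zalg rot_add[OF \<theta> \<theta>1]
  rot_scale[OF \<theta> \<theta>1])

lemma rot_pow_in_zalg: "f \<in> zalg \<Longrightarrow> (rot \<theta> ^^ i) f \<in> zalg"
  by (induction i) (auto intro: rot_in_zalg[OF \<theta> \<theta>1])

lemma rot_pow_add:
  "f \<in> zalg \<Longrightarrow> g \<in> zalg \<Longrightarrow> (rot \<theta> ^^ i) (f + g) = (rot \<theta> ^^ i) f + (rot \<theta> ^^ i) g"
  by (induction i) (simp_all add: rot_add[OF \<theta> \<theta>1] rot_pow_in_zalg)

lemma rot_pow_scale: "f \<in> zalg \<Longrightarrow> (rot \<theta> ^^ i) (scale r f) = scale r ((rot \<theta> ^^ i) f)"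
  by (induction i) (simp_all add: rot_scale[OF \<theta> \<theta>1] rot_pow_in_zalg)

lemma rot_pow_alt_prod:
  assumes "cs \<noteq> []" "set cs \<subseteq> zperp"
  shows "(rot \<theta> ^^ i) (alt_prod (zgen \<theta>) cs) = alt_prod (zgen \<theta>) (rotate i cs)"
  using assms by (induction i) (simp_all add: rot_alt_prod[OF \<theta> \<theta>1])

lemma sum_rotate_periodic:
  fixes h :: "'a list \<Rightarrow> 'c::ring_1"
  shows "(\<Sum>i<length cs * k. h (rotate i cs)) = of_nat k * (\<Sum>i<length cs. h (rotate i cs))"
proof (induction k)
  case (Suc k)
  have "(\<Sum>i<length cs * Suc k. h (rotate i cs)) =
      (\<Sum>i<length cs * k + length cs. h (rotate i cs))"
    by (simp add: add.commute)
  also have "\<dots> = (\<Sum>i<length cs * k. h (rotate i cs)) +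
      (\<Sum>i<length cs. h (rotate (length cs * k + i) cs))"
    by (rule sum_lessThan_add)
  also have "(\<Sum>i<length cs. h (rotate (length cs * k + i) cs)) = (\<Sum>i<length cs. h (rotate i cs))"
    by (intro sum.cong refl) (subst (1 2) rotate_conv_mod, simp)
  finally show ?case
    unfolding Suc by (simp add: distrib_right add.commute)
qed simp

text \<open>A monomial with factors \<open>cs\<close> has period \<open>length cs\<close> under rotation, and its average over a period is
  the derivative of \<open>alt_prod (zgen \<theta>) (cs @ [1])\<close> divided by \<open>length cs\<close>. Any multiple \<open>M\<close> of the
  period gives the same average, which allows linear combinations of monomials of different length.\<close>

lemma rotation_average_is_deriv:
  assumes "q \<in> zalg"
  shows "\<exists>N>0. \<forall>M>0. N dvd M \<longrightarrow>
    (\<exists>p\<in>zalg. insert_deriv p 1 = scale (1 / of_nat M) (\<Sum>i<M. (rot \<theta> ^^ i) q))"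
  using \<theta> \<theta>1 assms
proof (induction rule: zalg_alt_induct)
  case (alt cs)
  let ?A = "alt_prod (zgen \<theta>)"
  have one: "1 \<in> zperp" unfolding zperp_def by (rule subalg.one)
  show ?case
  proof (intro exI[of _ "length cs"] conjI allI impI)
    fix M :: nat assume "M > 0" "length cs dvd M"
    then obtain k where M: "M = length cs * k" "k > 0" by (auto elim: dvdE)
    define S where "S = (\<Sum>i<length cs. ?A (rotate i cs))"
    let ?p = "scale (1 / of_nat (length cs)) (?A (cs @ [1]))"
    have p: "?A (cs @ [1]) \<in> zalg"
      using alt one by (intro alt_prod_perp_in_zalg) auto
    have "(\<Sum>i<M. (rot \<theta> ^^ i) (?A cs)) = scale (of_nat k) S"
      using alt unfolding M S_def
      by (simp add: rot_pow_alt_prod scale_of_nat sum_rotate_periodic)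
    moreover have "insert_deriv ?p 1 = scale (1 / of_nat (length cs)) S"
      using alt p by (simp add: insert_deriv_scale insert_deriv_alt_prod_snoc_one S_def)
    ultimately have "insert_deriv ?p 1 = scale (1 / of_nat M) (\<Sum>i<M. (rot \<theta> ^^ i) (?A cs))"
      using M by (simp add: scale_scale)
    then show "\<exists>p\<in>zalg. insert_deriv p 1 = scale (1 / of_nat M) (\<Sum>i<M. (rot \<theta> ^^ i) (?A cs))"
      using p by (blast intro: zalg_closed)
  qed (use alt in simp)
next
  case (add f g)
  then obtain N L where N: "N > 0" "\<And>M. M > 0 \<Longrightarrow> N dvd M \<Longrightarrow>
      \<exists>p\<in>zalg. insert_deriv p 1 = scale (1 / of_nat M) (\<Sum>i<M. (rot \<theta> ^^ i) f)"
    and L: "L > 0" "\<And>M. M > 0 \<Longrightarrow> L dvd M \<Longrightarrow>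
      \<exists>p\<in>zalg. insert_deriv p 1 = scale (1 / of_nat M) (\<Sum>i<M. (rot \<theta> ^^ i) g)"
    by metis
  show ?case
  proof (intro exI[of _ "N * L"] conjI allI impI)
    fix M assume M: "M > 0" "N * L dvd M"
    then have "N dvd M" "L dvd M" by (auto dest: dvd_mult_left dvd_mult_right)
    with N(2) L(2) M obtain p r where "p \<in> zalg" "r \<in> zalg"
      "insert_deriv p 1 = scale (1 / of_nat M) (\<Sum>i<M. (rot \<theta> ^^ i) f)"
      "insert_deriv r 1 = scale (1 / of_nat M) (\<Sum>i<M. (rot \<theta> ^^ i) g)" by metis
    then show "\<exists>p\<in>zalg. insert_deriv p 1 = scale (1 / of_nat M) (\<Sum>i<M. (rot \<theta> ^^ i) (f + g))"
      using add by (intro bexI[of _ "p + r"])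
        (simp_all add: insert_deriv_add rot_pow_add sum.distrib scale_add_right zalg_closed)
  qed (use N L in simp)
next
  case (scale c f)
  then obtain N where N: "N > 0" "\<And>M. M > 0 \<Longrightarrow> N dvd M \<Longrightarrow>
      \<exists>p\<in>zalg. insert_deriv p 1 = scale (1 / of_nat M) (\<Sum>i<M. (rot \<theta> ^^ i) f)" by metis
  show ?case
  proof (intro exI[of _ N] conjI allI impI)
    fix M assume M: "M > 0" "N dvd M"
    with N(2) obtain p where "p \<in> zalg"
      "insert_deriv p 1 = scale (1 / of_nat M) (\<Sum>i<M. (rot \<theta> ^^ i) f)" by metis
    then show "\<exists>p\<in>zalg. insert_deriv p 1 = scale (1 / of_nat M) (\<Sum>i<M. (rot \<theta> ^^ i) (scale c f))"
      using scale by (intro bexI[of _ "scale c p"])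
        (simp_all add: insert_deriv_scale rot_pow_scale scale_scale mult.commute zalg_closed
          flip: scale_sum)
  qed (use N in simp)
qed

lemma insert_deriv_image_iff:
  assumes q: "q \<in> zalg"
  shows "(\<exists>p\<in>zalg. insert_deriv p 1 = q) \<longleftrightarrow> rot \<theta> q = q"
proof
  assume "\<exists>p\<in>zalg. insert_deriv p 1 = q"
  then show "rot \<theta> q = q" using rot_insert_deriv by blast
next
  assume "rot \<theta> q = q"
  then have pow: "(rot \<theta> ^^ i) q = q" for i
    by (induction i) simp_all
  from rotation_average_is_deriv[OF q] obtain N where "N > 0" and
    dvd: "\<forall>M>0. N dvd M \<longrightarrow>
      (\<exists>p\<in>zalg. insert_deriv p 1 = scale (1 / of_nat M) (\<Sum>i<M. (rot \<theta> ^^ i) q))"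
    by (elim exE conjE)
  note N = dvd[rule_format, OF \<open>N > 0\<close> dvd_refl]
  have "scale (1 / of_nat N) (\<Sum>i<N. (rot \<theta> ^^ i) q) = scale (1 / of_nat N) (scale (of_nat N) q)"
    by (simp add: pow scale_of_nat)
  also have "\<dots> = q"
    using \<open>N > 0\<close> by (simp add: scale_scale)
  finally show "\<exists>p\<in>zalg. insert_deriv p 1 = q" using N by simp
qed

end

theorem corollary9p6:
  fixes \<theta> :: "'b::complex_banach_algebra_1 \<Rightarrow> complex"
    and q :: "'b family"
  assumes "\<theta> \<in> top_dual" and "\<theta> 1 = 1"
    and "q \<in> Z_dual"
  shows "(\<exists>p \<in> Z_dual. cyclic_deriv p = q) \<longleftrightarrow> q \<in> ker_Theta \<theta>"
proof -
  from \<open>q \<in> Z_dual\<close> obtain q' where q: "q = Rep_mfam q'" and q': "q' \<in> zalg"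
    by (auto simp: Z_dual_eq)
  have "(\<exists>p \<in> Z_dual. cyclic_deriv p = q) \<longleftrightarrow> (\<exists>p\<in>zalg. insert_deriv p 1 = q')"
    by (simp add: Z_dual_eq q cyclic_deriv_Rep Rep_mfam_inject)
  also have "\<dots> \<longleftrightarrow> rot \<theta> q' = q'"
    by (rule insert_deriv_image_iff[OF assms(1,2) q'])
  also have "\<dots> \<longleftrightarrow> q' - rot \<theta> q' = 0"
    by auto
  also have "\<dots> \<longleftrightarrow> Theta \<theta> q = fam_zero"
    by (simp add: Theta_def q rho_eq[OF assms(1,2) q'] Rep_mfam_inject
      flip: minus_mfam.rep_eq zero_mfam.rep_eq)
  finally show ?thesis
    using assms(3) by (simp add: ker_Theta_def)
qed

end
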